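(* For $p\in(1,\infty)$ let $\theta_p=2\arcsin\big(\frac{2\sqrt{p-1}}p\big)$. Then, for every $p\in(1,\infty)$, there exists $C_p\in(0,\infty)$ such that for every $n,d\in\mathbb{N}$ with $d\in\{1,\ldots,n\}$ and every function $f:\{-1,1\}^n\to\mathbb{C}$ of degree at most $d$, we have $$\|\nabla f\|_{L_p(\{-1,1\}^n;\mathbb{C})}\leq\begin{cases}C_p\,d^{\frac2p-\frac{\theta_p}{p\pi}}\log(d+1)\,\|f\|_{L_p(\{-1,1\}^n;\mathbb{C})},&\text{if }p\in(1,2),\\[2pt]C_p\,d^{1-\frac{\theta_p}{2\pi}}\,\|f\|_{L_p(\{-1,1\}^n;\mathbb{C})},&\text{if }p\in[2,\infty).\end{cases}$$
   Context: $\mathbb{N}=\{1,2,\ldots\}$; $\log$ is the natural logarithm. For $p\in[1,\infty)$, $\|f\|_{L_p(\{-1,1\}^n;\mathbb{C})}=\big(2^{-n}\sum_{\varepsilon\in\{-1,1\}^n}|f(\varepsilon)|^p\big)^{1/p}$. For $A\subseteq\{1,\ldots,n\}$, the Walsh function is $w_A(\varepsilon)=\prod_{i\in A}\varepsilon_i$. Every $f:\{-1,1\}^n\to\mathbb{C}$ has the expansion $f=\sum_{A}\widehat f(A)w_A$ with $\widehat f(A)=2^{-n}\sum_{\delta}f(\delta)w_A(\delta)$. A function $f$ has degree at most $d$ if $\widehat f(A)=0$ whenever $|A|>d$. The partial derivatives are $\partial_if(\varepsilon)=\frac{f(\varepsilon)-f(\varepsilon_1,\ldots,\varepsilon_{i-1},-\varepsilon_i,\varepsilon_{i+1},\ldots,\varepsilon_n)}2$,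 and $\|\nabla f\|_{L_p(\{-1,1\}^n;\mathbb{C})}=\big\|\big(\sum_{i=1}^n|\partial_if|^2\big)^{1/2}\big\|_{L_p(\{-1,1\}^n;\mathbb{C})}$. *)

theory Defs
  imports "HOL-Analysis.Analysis"
begin

text \<open>
  The points of the discrete cube are the extensional functions on \<open>{1..n}\<close>, so that there are
  exactly \<open>2 ^ n\<close> of them. A function on the cube is a total function on \<open>nat \<Rightarrow> real\<close>; all notions
  below evaluate it at points of the cube only.
\<close>

definition cube :: "nat \<Rightarrow> (nat \<Rightarrow> real) set" where
  "cube n = {1..n} \<rightarrow>\<^sub>E {-1, 1}"

text \<open>The value type is left general so that the same norm applies to \<open>f\<close> and to the
  real-valued length of its gradient.\<close>

definition cube_Lp_norm :: "real \<Rightarrow> nat \<Rightarrow> ((nat \<Rightarrow> real) \<Rightarrow> 'b::real_normed_vector) \<Rightarrow> real" where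
  "cube_Lp_norm p n f = ((\<Sum>\<epsilon>\<in>cube n. norm (f \<epsilon>) powr p) / 2 ^ n) powr (1 / p)"

definition walsh :: "nat set \<Rightarrow> (nat \<Rightarrow> real) \<Rightarrow> complex" where
  "walsh A \<epsilon> = (\<Prod>i\<in>A. complex_of_real (\<epsilon> i))"

definition walsh_coeff :: "nat \<Rightarrow> ((nat \<Rightarrow> real) \<Rightarrow> complex) \<Rightarrow> nat set \<Rightarrow> complex" where
  "walsh_coeff n f A = (\<Sum>\<delta>\<in>cube n. f \<delta> * walsh A \<delta>) / 2 ^ n"

definition degree_at_most :: "nat \<Rightarrow> nat \<Rightarrow> ((nat \<Rightarrow> real) \<Rightarrow> complex) \<Rightarrow> bool" where
  "degree_at_most n d f \<longleftrightarrow> (\<forall>A. A \<subseteq> {1..n} \<and> d < card A \<longrightarrow> walsh_coeff n f A = 0)"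

definition cube_partial :: "nat \<Rightarrow> ((nat \<Rightarrow> real) \<Rightarrow> complex) \<Rightarrow> (nat \<Rightarrow> real) \<Rightarrow> complex" where
  "cube_partial i f \<epsilon> = (f \<epsilon> - f (\<epsilon>(i := - \<epsilon> i))) / 2"

definition grad_length :: "nat \<Rightarrow> ((nat \<Rightarrow> real) \<Rightarrow> complex) \<Rightarrow> (nat \<Rightarrow> real) \<Rightarrow> real" where
  "grad_length n f \<epsilon> = sqrt (\<Sum>i=1..n. (cmod (cube_partial i f \<epsilon>))\<^sup>2)"

definition grad_Lp_norm :: "real \<Rightarrow> nat \<Rightarrow> ((nat \<Rightarrow> real) \<Rightarrow> complex) \<Rightarrow> real" where
  "grad_Lp_norm p n f = cube_Lp_norm p n (grad_length n f)"

definition theta :: "real \<Rightarrow> real" where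
  "theta p = 2 * arcsin (2 * sqrt (p - 1) / p)"

end

theory Submission
  imports Defs "HOL-Complex_Analysis.Conformal_Mappings"
begin

text \<open>
  Let \<open>T\<^sub>w\<close> multiply each Walsh function \<open>w\<^sub>A\<close> by \<open>w ^ card A\<close>, put \<open>P\<^sub>z = T\<^sub>w\<close> with \<open>w = exp (- z)\<close>, and
  let \<open>\<beta> = 2 - theta p / pi\<close>. For \<open>t = d powr (- \<beta>)\<close> one has \<open>f = P\<^sub>t (P\<^sub>-\<^sub>t f)\<close>, so the theorem
  follows from two dimension-free facts: \<open>P\<^sub>-\<^sub>t\<close> is bounded in \<open>L\<^sub>p\<close>, uniformly in \<open>d\<close>, on functions of
  degree at most \<open>d\<close> (\<open>sum_noise_inverse_le\<close>), and for \<open>0 < t \<le> 1\<close> the gradient of \<open>P\<^sub>t g\<close> has norm at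
  most a constant times \<open>t powr (- max (1/2) (1/p))\<close> times the norm of \<open>g\<close>
  (\<open>sum_grad_length_noise_powr_le\<close>). The exponents of the theorem are \<open>\<beta> / 2\<close> for \<open>p \<ge> 2\<close> and
  \<open>\<beta> / p\<close> for \<open>p < 2\<close>.

  The first fact is where \<open>theta p\<close> enters. Along a ray from \<open>0\<close> in direction \<open>z\<close>, the derivative of
  \<open>r \<mapsto> \<parallel>P\<^sub>r\<^sub>z f\<parallel>\<^sub>p\<^sup>p\<close> is a negative multiple of a sum over the edges of the cube of \<open>Re (z * X)\<close>, where
  \<open>X = (a - b) * cnj (a * \<bar>a\<bar> powr (p - 2) - b * \<bar>b\<bar> powr (p - 2))\<close> and \<open>a\<close>, \<open>b\<close> are the values at the two
  ends. All these \<open>X\<close> lie in a sector around the positive axis whose half-angle is complementary to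
  \<open>theta p / 2\<close> (\<open>two_point_form_sector\<close>), hence \<open>P\<^sub>z\<close> is a contraction for \<open>\<bar>Arg z\<bar> \<le> theta p / 2\<close>.
  Pairing \<open>T\<^sub>w f\<close> with a fixed function gives a polynomial of degree at most \<open>d\<close> in \<open>w\<close>. It is bounded
  on the image of the sector under \<open>z \<mapsto> exp (- z)\<close>, a region with a corner of angle \<open>theta p\<close> at \<open>1\<close>. The
  exterior angle is \<open>\<beta> * pi\<close>, so \<open>s \<mapsto> s powr \<beta>\<close> maps a half-plane onto the exterior, and in terms of \<open>s\<close> the polynomial
  grows at most like \<open>exp (K * d * s)\<close>; at distance \<open>s = 1 / d\<close>, that is at \<open>w = exp t\<close>, it is therefore still
  bounded (\<open>polynomial_bound_outside_spiral_corner\<close>).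

  For the second fact and \<open>p \<ge> 2\<close>, \<open>P\<^sub>t f\<close> at a point is the mean of \<open>f\<close> under a product measure, and its partial
  derivatives are multiples of the covariances of \<open>f\<close> with the coordinates. By Bessel's inequality
  \<open>2 * t * \<bar>\<nabla>P\<^sub>t f\<bar>\<^sup>2 \<le> P\<^sub>t \<bar>f\<bar>\<^sup>2\<close> at every point. For \<open>p < 2\<close> the dissipation of
  \<open>\<parallel>P\<^sub>s f\<parallel>\<^sub>p\<^sup>p\<close> over \<open>0 \<le> s \<le> t\<close> is at most \<open>\<parallel>f\<parallel>\<^sub>p\<^sup>p\<close>, so at some time \<open>s < t\<close> its rate is at most \<open>1 / t\<close> times
  this. For nonnegative \<open>f\<close> the rate controls the gradient at time \<open>s\<close>, and the norm of the gradient
  decreases from time \<open>s\<close> to time \<open>t\<close>; a complex \<open>f\<close> is a combination of four nonnegative functions.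
\<close>

section \<open>The two-point inequality\<close>

text \<open>
  Up to normalisation, \<open>duality_map p \<circ> f\<close> is the functional on \<open>L\<^sub>p\<close> that norms \<open>f\<close>.
\<close>

definition duality_map :: "real \<Rightarrow> complex \<Rightarrow> complex" where
  "duality_map p a = a * of_real (cmod a powr (p - 2))"

lemma norm_duality_map: "cmod (duality_map p a) = cmod a powr (p - 1)"
proof (cases "a = 0")
  case False
  then have "cmod a * cmod a powr (p - 2) = cmod a powr (1 + (p - 2))"
    by (subst powr_add) simp
  then show ?thesis by (simp add: duality_map_def norm_mult)
qed (simp add: duality_map_def)

lemma mult_cnj_duality_map: "a * cnj (duality_map p a) = of_real (cmod a powr p)"
proof (cases "a = 0")
  case False
  have "a * cnj (duality_map p a) = (a * cnj a) * of_real (cmod a powr (p - 2))"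
    by (simp add: duality_map_def)
  also have "\<dots> = of_real (cmod a powr 2 * cmod a powr (p - 2))"
    using False by (simp flip: complex_norm_square)
  also have "cmod a powr 2 * cmod a powr (p - 2) = cmod a powr p"
    by (simp only: powr_add[symmetric]) simp
  finally show ?thesis .
qed (simp add: duality_map_def)

lemma duality_map_of_real:
  "0 \<le> x \<Longrightarrow> duality_map p (of_real x) = of_real (x powr (p - 1))"
proof (cases "x = 0")
  case False
  assume "0 \<le> x"
  with False have "x * x powr (p - 2) = x powr (1 + (p - 2))"
    by (subst powr_add) simp
  with \<open>0 \<le> x\<close> show ?thesis by (simp add: duality_map_def flip: of_real_mult)
qed (simp add: duality_map_def)

text \<open>
  The function \<open>u \<mapsto> sinh (u * y) / u\<close> increases, because \<open>sinh\<close> is convex on the positive axis.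
\<close>

lemma sinh_ratio_le:
  fixes u v y :: real
  assumes "0 \<le> u" "u \<le> v" "0 \<le> y"
  shows "v * sinh (u * y) \<le> u * sinh (v * y)"
proof (rule DERIV_nonneg_imp_nondecreasing[where f = "\<lambda>y. u * sinh (v * y) - v * sinh (u * y)" and a = 0 and b = y, simplified, unfolded mult_zero_right sinh_0 diff_0_right diff_ge_0_iff_ge])
  show "0 \<le> y" by fact
  fix x :: real assume x: "0 \<le> x" "x \<le> y"
  have "cosh (u * x) \<le> cosh (v * x)"
    using assms x by (subst cosh_real_nonneg_le_iff) (auto intro: mult_right_mono)
  then have "0 \<le> u * v * (cosh (v * x) - cosh (u * x))" using assms by simp
  moreover have "((\<lambda>y. u * sinh (v * y) - v * sinh (u * y)) has_real_derivative
      u * v * (cosh (v * x) - cosh (u * x))) (at x)"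
    by (auto intro!: derivative_eq_intros simp: algebra_simps)
  ultimately show "\<exists>D. ((\<lambda>y. u * sinh (v * y) - v * sinh (u * y)) has_real_derivative D) (at x) \<and> 0 \<le> D"
    by blast
qed

text \<open>
  After division by \<open>(A * B) powr (p / 2)\<close> both sides are hyperbolic sines: with
  \<open>y = \<bar>ln (A / B)\<bar> / 2\<close> the claim compares \<open>sinh (\<bar>p - 2\<bar> * y)\<close> and \<open>sinh (p * y)\<close>.
\<close>

lemma powr_difference_comparison:
  fixes A B p :: real
  assumes p: "1 < p" and AB: "0 < A" "0 < B"
  shows "p * (A * B * \<bar>A powr (p - 2) - B powr (p - 2)\<bar>) \<le> \<bar>p - 2\<bar> * \<bar>A powr p - B powr p\<bar>"
proof -
  define y where "y = \<bar>ln A - ln B\<bar> / 2"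
  have sinh_abs: "\<bar>A powr q - B powr q\<bar> = 2 * exp (q * (ln A + ln B) / 2) * sinh (\<bar>q\<bar> * y)" for q
  proof -
    define m h where "m = q * (ln A + ln B) / 2" and "h = q * (ln A - ln B) / 2"
    have "A powr q = exp m * exp h" "B powr q = exp m * exp (- h)"
      using AB by (simp_all add: powr_def m_def h_def field_simps flip: exp_add)
    then have "A powr q - B powr q = 2 * exp m * sinh h"
      by (simp add: sinh_def algebra_simps)
    then have "\<bar>A powr q - B powr q\<bar> = 2 * exp m * \<bar>sinh h\<bar>" by (simp add: abs_mult)
    also have "\<bar>sinh h\<bar> = sinh \<bar>h\<bar>" by (simp add: abs_if)
    also have "\<bar>h\<bar> = \<bar>q\<bar> * y" by (simp add: h_def y_def abs_mult)
    finally show ?thesis by (simp add: m_def)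
  qed
  have AB': "A * B = exp (ln A + ln B)" using AB by (simp add: exp_add)
  have "p * (A * B * \<bar>A powr (p - 2) - B powr (p - 2)\<bar>) =
      2 * exp (p * (ln A + ln B) / 2) * (p * sinh (\<bar>p - 2\<bar> * y))"
  proof -
    have "exp (ln A + ln B) * exp ((p - 2) * (ln A + ln B) / 2) = exp (p * (ln A + ln B) / 2)"
      by (simp add: field_simps flip: exp_add)
    then show ?thesis unfolding sinh_abs AB' by (simp add: mult_ac)
  qed
  also have "\<dots> \<le> 2 * exp (p * (ln A + ln B) / 2) * (\<bar>p - 2\<bar> * sinh (p * y))"
    using p by (intro mult_left_mono sinh_ratio_le) (auto simp: y_def)
  also have "\<dots> = \<bar>p - 2\<bar> * \<bar>A powr p - B powr p\<bar>"
    using p unfolding sinh_abs by simp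
  finally show ?thesis .
qed

text \<open>
  The density of the dissipation of the \<open>L\<^sub>p\<close>-norm: \<open>a\<close> and \<open>b\<close> stand for the values of a function at the
  two ends of an edge of the cube.
\<close>

definition two_point_form :: "real \<Rightarrow> complex \<Rightarrow> complex \<Rightarrow> complex" where
  "two_point_form p a b = (a - b) * cnj (duality_map p a - duality_map p b)"

text \<open>
  If \<open>A\<close>, \<open>B\<close> are the moduli of \<open>a\<close>, \<open>b\<close> and \<open>w\<close> is the phase of \<open>a * cnj b\<close>, the form has real part
  \<open>T - S * Re w\<close> and the modulus of its imaginary part is \<open>c * \<bar>Im w\<bar>\<close>. Maximising over the phase by
  Cauchy-Schwarz leaves \<open>4 * (p - 1) * c\<^sup>2 + (p - 2)\<^sup>2 * S\<^sup>2 \<le> (p - 2)\<^sup>2 * T\<^sup>2\<close>. As \<open>S\<^sup>2 - c\<^sup>2\<close> equals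
  \<open>4 * M = T\<^sup>2 - (A powr p - B powr p)\<^sup>2\<close> and \<open>4 * (p - 1) + (p - 2)\<^sup>2 = p\<^sup>2\<close>, this is the square of
  \<open>powr_difference_comparison\<close>.
\<close>

lemma two_point_form_sector:
  assumes p: "1 < p"
  shows "2 * sqrt (p - 1) * \<bar>Im (two_point_form p a b)\<bar> \<le> \<bar>p - 2\<bar> * Re (two_point_form p a b)"
proof (cases "a = 0 \<or> b = 0")
  case True
  have "two_point_form p a b = of_real (cmod (if a = 0 then b else a) powr p)"
    using True mult_cnj_duality_map[of a p] mult_cnj_duality_map[of b p]
    by (auto simp: two_point_form_def duality_map_def)
  then show ?thesis by simp
next
  case False
  define A B where "A = cmod a" and "B = cmod b"
  have AB: "0 < A" "0 < B" using False by (auto simp: A_def B_def)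
  define M c S T where "M = A powr p * B powr p"
    and "c = A * B * \<bar>A powr (p - 2) - B powr (p - 2)\<bar>"
    and "S = A * B * (A powr (p - 2) + B powr (p - 2))" and "T = A powr p + B powr p"
  define w where "w = a * cnj b / of_real (A * B)"
  have abw: "a * cnj b = of_real (A * B) * w" "b * cnj a = of_real (A * B) * cnj w"
    using AB by (simp_all add: w_def)
  have normw: "cmod w = 1" using False by (simp add: w_def norm_mult norm_divide A_def B_def)
  have X: "two_point_form p a b = of_real T - of_real (A * B) *
      (of_real (B powr (p - 2)) * w + of_real (A powr (p - 2)) * cnj w)"
  proof -
    have "two_point_form p a b = a * cnj (duality_map p a) + b * cnj (duality_map p b)
        - (a * cnj b * of_real (B powr (p - 2)) + b * cnj a * of_real (A powr (p - 2)))"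
      by (simp add: two_point_form_def duality_map_def A_def B_def algebra_simps)
    then show ?thesis unfolding mult_cnj_duality_map abw
      by (simp add: T_def A_def B_def algebra_simps)
  qed
  have Re: "Re (two_point_form p a b) = T - S * Re w"
    by (simp add: X S_def algebra_simps)
  have "Im (two_point_form p a b) = A * B * (A powr (p - 2) - B powr (p - 2)) * Im w"
    by (simp add: X algebra_simps)
  then have Im: "\<bar>Im (two_point_form p a b)\<bar> = c * \<bar>Im w\<bar>"
    using AB by (simp add: c_def abs_mult)
  have powp: "A powr p = A\<^sup>2 * A powr (p - 2)" "B powr p = B\<^sup>2 * B powr (p - 2)"
    using AB by (simp_all add: powr_diff)
  have c2: "c\<^sup>2 = S\<^sup>2 - 4 * M"
    by (simp add: c_def S_def M_def powp power_mult_distrib) algebra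
  have T2: "\<bar>A powr p - B powr p\<bar>\<^sup>2 = T\<^sup>2 - 4 * M"
    unfolding power2_abs T_def M_def by algebra
  have "0 \<le> c" using AB by (simp add: c_def)
  have "(p * c)\<^sup>2 \<le> (\<bar>p - 2\<bar> * \<bar>A powr p - B powr p\<bar>)\<^sup>2"
    using powr_difference_comparison[OF p AB] p \<open>0 \<le> c\<close>
    by (intro power_mono) (auto simp: c_def)
  then have key: "p\<^sup>2 * c\<^sup>2 \<le> (p - 2)\<^sup>2 * (T\<^sup>2 - 4 * M)"
    using T2 by (simp only: power_mult_distrib power2_abs)
  have w2: "(Re w)\<^sup>2 + (Im w)\<^sup>2 = 1" using normw by (simp add: cmod_def)
  have "(2 * sqrt (p - 1) * c * \<bar>Im w\<bar> + \<bar>p - 2\<bar> * S * Re w)\<^sup>2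
      \<le> ((2 * sqrt (p - 1) * c)\<^sup>2 + (\<bar>p - 2\<bar> * S)\<^sup>2) * (\<bar>Im w\<bar>\<^sup>2 + (Re w)\<^sup>2)"
  proof -
    have "((2 * sqrt (p - 1) * c)\<^sup>2 + (\<bar>p - 2\<bar> * S)\<^sup>2) * (\<bar>Im w\<bar>\<^sup>2 + (Re w)\<^sup>2)
      - (2 * sqrt (p - 1) * c * \<bar>Im w\<bar> + \<bar>p - 2\<bar> * S * Re w)\<^sup>2
      = (2 * sqrt (p - 1) * c * Re w - \<bar>p - 2\<bar> * S * \<bar>Im w\<bar>)\<^sup>2"
      by (simp only: power2_eq_square ring_distribs left_diff_distrib right_diff_distrib mult_ac)
    then show ?thesis by (metis diff_ge_0_iff_ge zero_le_power2)
  qed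
  also have "\<dots> = 4 * (p - 1) * c\<^sup>2 + (p - 2)\<^sup>2 * S\<^sup>2"
    using p w2 by (simp add: power_mult_distrib add.commute)
  also have "\<dots> = p\<^sup>2 * c\<^sup>2 + (p - 2)\<^sup>2 * (4 * M)"
    unfolding c2 by algebra
  also have "\<dots> \<le> (\<bar>p - 2\<bar> * T)\<^sup>2"
    using key by (simp add: power_mult_distrib algebra_simps)
  finally have "2 * sqrt (p - 1) * c * \<bar>Im w\<bar> + \<bar>p - 2\<bar> * S * Re w \<le> \<bar>p - 2\<bar> * T"
    by (rule power2_le_imp_le) (simp add: T_def)
  then show ?thesis unfolding Re Im by (simp add: algebra_simps)
qed

text \<open>
  The sector allowed for \<open>z\<close> and the sector containing the form have complementary half-angles, so the
  argument of the product is at most a right angle.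
\<close>

lemma Re_two_point_form_nonneg:
  assumes p: "1 < p" and z: "\<bar>p - 2\<bar> * \<bar>Im z\<bar> \<le> 2 * sqrt (p - 1) * Re z"
  shows "0 \<le> Re (z * two_point_form p a b)"
proof -
  define X where "X = two_point_form p a b"
  define k l where "k = 2 * sqrt (p - 1)" and "l = \<bar>p - 2\<bar>"
  have X: "k * \<bar>Im X\<bar> \<le> l * Re X"
    using two_point_form_sector[OF p] by (simp add: X_def k_def l_def)
  have z': "l * \<bar>Im z\<bar> \<le> k * Re z" using z by (simp add: k_def l_def)
  have k: "0 < k" using p by (simp add: k_def)
  have l: "0 \<le> l" by (simp add: l_def)
  have Rez: "0 \<le> Re z"
    using z' k l by (metis abs_ge_zero mult_nonneg_nonneg order_trans zero_le_mult_iff not_less)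
  show ?thesis
  proof (cases "l = 0")
    case True
    then have "p = 2" by (simp add: l_def)
    then have "X = (a - b) * cnj (a - b)"
      by (cases "a = 0"; cases "b = 0") (auto simp: X_def two_point_form_def duality_map_def)
    then have "X = of_real ((cmod (a - b))\<^sup>2)" by (simp only: complex_norm_square)
    then show ?thesis using Rez by (simp flip: X_def)
  next
    case False
    then have l: "0 < l" using l by simp
    have ReX: "0 \<le> Re X"
      using X k l by (metis abs_ge_zero mult_nonneg_nonneg order_trans zero_le_mult_iff not_less less_imp_le)
    have "(l * \<bar>Im z\<bar>) * (k * \<bar>Im X\<bar>) \<le> (k * Re z) * (l * Re X)"
      using X z' k l Rez by (intro mult_mono[OF z' X]) auto
    then have "(k * l) * (\<bar>Im z\<bar> * \<bar>Im X\<bar>) \<le> (k * l) * (Re z * Re X)" by (simp add: mult_ac)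
    then have "\<bar>Im z * Im X\<bar> \<le> Re z * Re X" using k l by (simp add: abs_mult)
    then show ?thesis by (simp flip: X_def)
  qed
qed

section \<open>Noise operators on the cube\<close>

lemma finite_cube [simp]: "finite (cube n)"
  by (auto simp: cube_def intro: finite_PiE)

lemma cube_cases: "\<epsilon> \<in> cube n \<Longrightarrow> i \<in> {1..n} \<Longrightarrow> \<epsilon> i = 1 \<or> \<epsilon> i = -1"
  by (auto simp: cube_def PiE_def Pi_def)

lemma flip_in_cube: "\<epsilon> \<in> cube n \<Longrightarrow> i \<in> {1..n} \<Longrightarrow> \<epsilon>(i := - \<epsilon> i) \<in> cube n"
  using cube_cases[of \<epsilon> n i] unfolding cube_def by (auto simp: PiE_iff extensional_def)

lemma cube_eqI: "\<epsilon> \<in> cube n \<Longrightarrow> \<delta> \<in> cube n \<Longrightarrow> (\<And>i. i \<in> {1..n} \<Longrightarrow> \<epsilon> i = \<delta> i) \<Longrightarrow> \<epsilon> = \<delta>"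
  unfolding cube_def by (rule PiE_ext)

lemma sum_cube_flip:
  fixes g :: "(nat \<Rightarrow> real) \<Rightarrow> 'a::comm_monoid_add"
  assumes "i \<in> {1..n}"
  shows "(\<Sum>\<epsilon>\<in>cube n. g (\<epsilon>(i := - \<epsilon> i))) = (\<Sum>\<epsilon>\<in>cube n. g \<epsilon>)"
  by (rule sum.reindex_bij_witness[where i = "\<lambda>\<epsilon>. \<epsilon>(i := - \<epsilon> i)" and j = "\<lambda>\<epsilon>. \<epsilon>(i := - \<epsilon> i)"])
    (use assms flip_in_cube in auto)

lemma sum_cube_prod:
  fixes g :: "nat \<Rightarrow> real \<Rightarrow> 'a::comm_ring_1"
  shows "(\<Sum>\<epsilon>\<in>cube n. \<Prod>i=1..n. g i (\<epsilon> i)) = (\<Prod>i=1..n. g i 1 + g i (-1))"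
  unfolding cube_def by (subst prod_sum_PiE[symmetric]) (auto intro!: prod.cong)

definition noise_kernel :: "nat \<Rightarrow> 'a \<Rightarrow> (nat \<Rightarrow> real) \<Rightarrow> (nat \<Rightarrow> real) \<Rightarrow> 'a::real_normed_field" where
  "noise_kernel n w \<epsilon> \<delta> = (\<Prod>i=1..n. 1 + w * of_real (\<epsilon> i * \<delta> i))"

text \<open>
  The kernel has constant term one in \<open>w\<close>, and its expansion in Walsh functions makes \<open>noise n w\<close> the operator
  that multiplies \<open>walsh A\<close> by \<open>w ^ card A\<close> (\<open>noise_walsh_expansion\<close>). The kernel form is the definition
  because positivity for real \<open>w\<close> can be read off from it. The value type is left general so that the
  same operator acts on real functions, such as lengths of gradients.
\<close>

definition noise :: "nat \<Rightarrow> 'a \<Rightarrow> ((nat \<Rightarrow> real) \<Rightarrow> 'a) \<Rightarrow> (nat \<Rightarrow> real) \<Rightarrow> 'a::real_normed_field" where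
  "noise n w f \<epsilon> = (\<Sum>\<delta>\<in>cube n. noise_kernel n w \<epsilon> \<delta> * f \<delta>) / 2 ^ n"

lemma noise_kernel_sym: "noise_kernel n w \<epsilon> \<delta> = noise_kernel n w \<delta> \<epsilon>"
  by (simp add: noise_kernel_def mult.commute)

lemma noise_kernel_flip:
  "noise_kernel n w (\<epsilon>(i := - \<epsilon> i)) \<delta> = noise_kernel n w \<epsilon> (\<delta>(i := - \<delta> i))"
  unfolding noise_kernel_def by (intro prod.cong) auto

lemma sum_noise_kernel_mult:
  assumes "\<epsilon> \<in> cube n" "\<eta> \<in> cube n"
  shows "(\<Sum>\<delta>\<in>cube n. noise_kernel n w \<epsilon> \<delta> * noise_kernel n v \<delta> \<eta>) = 2 ^ n * noise_kernel n (w * v) \<epsilon> \<eta>"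
proof -
  have "(\<Sum>\<delta>\<in>cube n. noise_kernel n w \<epsilon> \<delta> * noise_kernel n v \<delta> \<eta>) =
      (\<Sum>\<delta>\<in>cube n. \<Prod>i=1..n. (1 + w * of_real (\<epsilon> i * \<delta> i)) * (1 + v * of_real (\<delta> i * \<eta> i)))"
    by (simp add: noise_kernel_def prod.distrib)
  also have "\<dots> = (\<Prod>i=1..n. 2 * (1 + w * v * of_real (\<epsilon> i * \<eta> i)))"
    by (subst sum_cube_prod[where g = "\<lambda>i x. (1 + w * of_real (\<epsilon> i * x)) * (1 + v * of_real (x * \<eta> i))"])
      (simp add: algebra_simps)
  also have "\<dots> = 2 ^ n * noise_kernel n (w * v) \<epsilon> \<eta>"
    unfolding noise_kernel_def prod.distrib by simp
  finally show ?thesis .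
qed

lemma noise_kernel_one:
  assumes "\<epsilon> \<in> cube n" "\<delta> \<in> cube n"
  shows "noise_kernel n 1 \<epsilon> \<delta> = (if \<epsilon> = \<delta> then 2 ^ n else 0)"
proof (cases "\<epsilon> = \<delta>")
  case True
  have "noise_kernel n 1 \<epsilon> \<delta> = (\<Prod>i=1..n. (2::'a))"
    unfolding noise_kernel_def True
    using cube_cases[OF assms(2)] by (intro prod.cong) fastforce+
  then show ?thesis using True by simp
next
  case False
  then obtain i where i: "i \<in> {1..n}" "\<epsilon> i \<noteq> \<delta> i" using cube_eqI assms by metis
  \<comment> \<open>A coordinate in which the two points differ makes one factor of the kernel vanish.\<close>
  then have "\<epsilon> i * \<delta> i = -1"
    using cube_cases[OF assms(1), of i] cube_cases[OF assms(2), of i] by auto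
  then have "1 + 1 * of_real (\<epsilon> i * \<delta> i) = (0::'a)" by simp
  then show ?thesis using False i by (auto simp: noise_kernel_def intro!: prod_zero)
qed

lemma noise_noise:
  assumes "\<epsilon> \<in> cube n"
  shows "noise n w (noise n v f) \<epsilon> = noise n (w * v) f \<epsilon>"
proof -
  have "noise n w (noise n v f) \<epsilon> =
      (\<Sum>\<delta>\<in>cube n. \<Sum>\<eta>\<in>cube n. noise_kernel n w \<epsilon> \<delta> * noise_kernel n v \<delta> \<eta> * f \<eta>) / (2 ^ n * 2 ^ n)"
    by (simp add: noise_def sum_distrib_left mult.assoc flip: sum_divide_distrib)
  also have "\<dots> = (\<Sum>\<eta>\<in>cube n. (\<Sum>\<delta>\<in>cube n. noise_kernel n w \<epsilon> \<delta> * noise_kernel n v \<delta> \<eta>) * f \<eta>) / (2 ^ n * 2 ^ n)"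
    by (subst sum.swap) (simp add: sum_distrib_right)
  also have "\<dots> = noise n (w * v) f \<epsilon>"
    using assms by (simp add: sum_noise_kernel_mult noise_def mult.assoc flip: sum_distrib_left)
  finally show ?thesis .
qed

lemma noise_one:
  assumes "\<epsilon> \<in> cube n" shows "noise n 1 f \<epsilon> = f \<epsilon>"
proof -
  have "noise n 1 f \<epsilon> = (\<Sum>\<delta>\<in>cube n. if \<epsilon> = \<delta> then 2 ^ n * f \<delta> else 0) / 2 ^ n"
    unfolding noise_def using assms
    by (intro arg_cong2[where f = "(/)"] sum.cong refl) (simp add: noise_kernel_one)
  then show ?thesis using assms by simp
qed

lemma noise_walsh_expansion:
  fixes f :: "(nat \<Rightarrow> real) \<Rightarrow> complex"
  shows "noise n w f \<epsilon> = (\<Sum>A\<in>Pow {1..n}. w ^ card A * (walsh_coeff n f A * walsh A \<epsilon>))"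
proof -
  have "noise_kernel n w \<epsilon> \<delta> = (\<Sum>A\<in>Pow {1..n}. w ^ card A * walsh A \<epsilon> * walsh A \<delta>)" for \<delta>
  proof -
    have "noise_kernel n w \<epsilon> \<delta> = (\<Prod>i\<in>{1..n}. w * of_real (\<epsilon> i * \<delta> i) + 1)"
      by (simp add: noise_kernel_def add.commute)
    also have "\<dots> = (\<Sum>A\<in>Pow {1..n}. \<Prod>i\<in>A. w * of_real (\<epsilon> i * \<delta> i))"
      by (subst prod_add) auto
    finally show ?thesis by (simp add: walsh_def prod.distrib mult.assoc)
  qed
  then have "noise n w f \<epsilon> = (\<Sum>\<delta>\<in>cube n. \<Sum>A\<in>Pow {1..n}. w ^ card A * walsh A \<epsilon> * walsh A \<delta> * f \<delta>) / 2 ^ n"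
    by (simp add: noise_def sum_distrib_right)
  also have "\<dots> = (\<Sum>A\<in>Pow {1..n}. w ^ card A * (walsh_coeff n f A * walsh A \<epsilon>))"
    by (subst sum.swap) (simp add: walsh_coeff_def sum_divide_distrib sum_distrib_left sum_distrib_right mult_ac)
  finally show ?thesis .
qed

lemma sum_cube_noise_uminus:
  fixes g :: "'a::real_normed_field \<Rightarrow> 'b::comm_monoid_add"
  shows "(\<Sum>\<epsilon>\<in>cube n. g (noise n (- w) f \<epsilon>)) = (\<Sum>\<epsilon>\<in>cube n. g (noise n w f \<epsilon>))"
proof -
  define neg :: "(nat \<Rightarrow> real) \<Rightarrow> nat \<Rightarrow> real" where "neg \<epsilon> = restrict (\<lambda>i. - \<epsilon> i) {1..n}" for \<epsilon>
  have neg: "neg \<epsilon> \<in> cube n" "neg (neg \<epsilon>) = \<epsilon>" if "\<epsilon> \<in> cube n" for \<epsilon>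
    using that by (auto simp: neg_def cube_def PiE_iff extensional_def restrict_def fun_eq_iff)
  have "noise_kernel n (- w) \<epsilon> \<delta> = noise_kernel n w (neg \<epsilon>) \<delta>" for \<epsilon> \<delta>
    unfolding noise_kernel_def by (intro prod.cong) (auto simp: neg_def)
  then have "noise n (- w) f \<epsilon> = noise n w f (neg \<epsilon>)" for \<epsilon> by (simp add: noise_def)
  then show ?thesis
    by (intro sum.reindex_bij_witness[where i = neg and j = neg]) (auto simp: neg)
qed

lemma noise_diff: "noise n w (\<lambda>\<delta>. f \<delta> - g \<delta>) \<epsilon> = noise n w f \<epsilon> - noise n w g \<epsilon>"
  by (simp add: noise_def right_diff_distrib sum_subtractf diff_divide_distrib)

lemma noise_add: "noise n w (\<lambda>\<delta>. f \<delta> + g \<delta>) \<epsilon> = noise n w f \<epsilon> + noise n w g \<epsilon>"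
  by (simp add: noise_def distrib_left sum.distrib add_divide_distrib)

lemma noise_cmult: "noise n w (\<lambda>\<delta>. c * f \<delta>) \<epsilon> = c * noise n w f \<epsilon>"
  by (simp add: noise_def sum_distrib_left mult_ac)

lemma noise_sum: "noise n w (\<lambda>\<delta>. \<Sum>i\<in>I. f i \<delta>) \<epsilon> = (\<Sum>i\<in>I. noise n w (f i) \<epsilon>)"
  by (induction I rule: infinite_finite_induct) (simp_all add: noise_add, simp_all add: noise_def)

lemma noise_cnj: "noise n (of_real \<rho>) (\<lambda>\<delta>. cnj (f \<delta>)) \<epsilon> = cnj (noise n (of_real \<rho>) f \<epsilon>)"
  by (simp add: noise_def noise_kernel_def)

lemma noise_of_real:
  "noise n (of_real \<rho>) (\<lambda>\<delta>. of_real (f \<delta>)) \<epsilon> = of_real (noise n \<rho> f \<epsilon>)"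
  by (simp add: noise_def noise_kernel_def)

lemma cube_partial_noise:
  assumes "i \<in> {1..n}"
  shows "cube_partial i (noise n w f) \<epsilon> = noise n w (cube_partial i f) \<epsilon>"
proof -
  have "noise n w f (\<epsilon>(i := - \<epsilon> i)) = noise n w (\<lambda>\<delta>. f (\<delta>(i := - \<delta> i))) \<epsilon>"
    using sum_cube_flip[OF assms, of "\<lambda>\<delta>. noise_kernel n w \<epsilon> (\<delta>(i := - \<delta> i)) * f \<delta>"]
    by (simp add: noise_def noise_kernel_flip)
  moreover have "noise n w (cube_partial i f) \<epsilon> =
      1 / 2 * (noise n w f \<epsilon> - noise n w (\<lambda>\<delta>. f (\<delta>(i := - \<delta> i))) \<epsilon>)"
    unfolding noise_diff[symmetric] noise_cmult[symmetric] by (simp add: cube_partial_def[abs_def])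
  ultimately show ?thesis by (simp add: cube_partial_def)
qed

text \<open>
  The left side is the partial derivative of the kernel as a function on the cube, and the right side is
  the \<open>i\<close>-th term of \<open>2 * w\<close> times the derivative of the kernel in \<open>w\<close>. This identity makes \<open>w * d/dw\<close>
  act on \<open>noise n w f\<close> as the sum of the partial derivatives.
\<close>

lemma noise_kernel_flip_difference:
  assumes "i \<in> {1..n}"
  shows "noise_kernel n w \<epsilon> \<delta> - noise_kernel n w (\<epsilon>(i := - \<epsilon> i)) \<delta> =
    2 * (w * of_real (\<epsilon> i * \<delta> i) * (\<Prod>j\<in>{1..n} - {i}. 1 + w * of_real (\<epsilon> j * \<delta> j)))"
proof -
  have split: "noise_kernel n w \<eta> \<delta> = (1 + w * of_real (\<eta> i * \<delta> i)) *
      (\<Prod>j\<in>{1..n} - {i}. 1 + w * of_real (\<eta> j * \<delta> j))" for \<eta>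
    unfolding noise_kernel_def using assms by (intro prod.remove) auto
  have "(\<Prod>j\<in>{1..n} - {i}. 1 + w * of_real ((\<epsilon>(i := - \<epsilon> i)) j * \<delta> j)) =
      (\<Prod>j\<in>{1..n} - {i}. 1 + w * of_real (\<epsilon> j * \<delta> j))"
    by (intro prod.cong) auto
  then show ?thesis unfolding split by (simp add: algebra_simps)
qed

text \<open>
  The operators \<open>noise n (exp (- z))\<close> form the heat semigroup of the cube, whose generator is minus the
  sum of the partial derivatives.
\<close>

lemma noise_has_vector_derivative:
  fixes f :: "(nat \<Rightarrow> real) \<Rightarrow> complex"
  shows "((\<lambda>r. noise n (exp (- (of_real r * z))) f \<epsilon>) has_vector_derivative
     - z * (\<Sum>i=1..n. cube_partial i (noise n (exp (- (of_real r * z))) f) \<epsilon>)) (at r)"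
proof -
  define K where "K = (\<lambda>w \<delta>. \<Sum>i=1..n. of_real (\<epsilon> i * \<delta> i) *
      (\<Prod>j\<in>{1..n} - {i}. 1 + w * of_real (\<epsilon> j * \<delta> j)) :: complex)"
  define D where "D = (\<lambda>w. (\<Sum>\<delta>\<in>cube n. K w \<delta> * f \<delta>) / 2 ^ n)"
  have kernel: "((\<lambda>w. noise_kernel n w \<epsilon> \<delta>) has_field_derivative K w \<delta>) (at w)" for w \<delta>
    unfolding noise_kernel_def K_def
    by (rule has_field_derivative_prod) (auto intro!: derivative_eq_intros)
  have "((\<lambda>w. noise n w f \<epsilon>) has_field_derivative D w) (at w)" for w
    unfolding noise_def D_def
    by (intro DERIV_cdivide DERIV_sum) (auto intro!: derivative_eq_intros kernel)
  moreover have "((\<lambda>r::real. exp (- (of_real r * z))) has_vector_derivative - z * exp (- (of_real r * z))) (at r)"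
    by (rule has_vector_derivative_real_field) (auto intro!: derivative_eq_intros)
  ultimately have "((\<lambda>r. noise n (exp (- (of_real r * z))) f \<epsilon>) has_vector_derivative
     - z * exp (- (of_real r * z)) * D (exp (- (of_real r * z)))) (at r)"
    using field_vector_diff_chain_at by (fastforce simp: o_def)
  moreover have "w * D w = (\<Sum>i=1..n. cube_partial i (noise n w f) \<epsilon>)" for w
  proof -
    have "w * K w \<delta> = (\<Sum>i=1..n. (noise_kernel n w \<epsilon> \<delta> - noise_kernel n w (\<epsilon>(i := - \<epsilon> i)) \<delta>) / 2)" for \<delta>
      unfolding K_def sum_distrib_left
      by (intro sum.cong refl) (simp add: noise_kernel_flip_difference mult_ac)
    then have "w * D w = (\<Sum>\<delta>\<in>cube n. (\<Sum>i=1..n. (noise_kernel n w \<epsilon> \<delta> - noise_kernel n w (\<epsilon>(i := - \<epsilon> i)) \<delta>) / 2) * f \<delta>) / 2 ^ n"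
      by (simp add: D_def sum_distrib_left flip: mult.assoc)
    also have "\<dots> = (\<Sum>i=1..n. (\<Sum>\<delta>\<in>cube n. (noise_kernel n w \<epsilon> \<delta> - noise_kernel n w (\<epsilon>(i := - \<epsilon> i)) \<delta>) / 2 * f \<delta>) / 2 ^ n)"
      by (subst sum_divide_distrib[symmetric], subst sum.swap) (simp add: sum_distrib_right)
    also have "\<dots> = (\<Sum>i=1..n. cube_partial i (noise n w f) \<epsilon>)"
      by (intro sum.cong refl)
        (simp add: cube_partial_def noise_def left_diff_distrib right_diff_distrib diff_divide_distrib
          sum_subtractf sum_divide_distrib mult_ac)
    finally show ?thesis .
  qed
  ultimately show ?thesis by (simp add: mult.assoc)
qed

section \<open>Averaging by real noise\<close>

lemma noise_kernel_nonneg: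
  fixes \<rho> :: real
  assumes "\<epsilon> \<in> cube n" "\<delta> \<in> cube n" "\<bar>\<rho>\<bar> \<le> 1"
  shows "0 \<le> noise_kernel n \<rho> \<epsilon> \<delta>"
  unfolding noise_kernel_def
proof (rule prod_nonneg)
  fix i assume "i \<in> {1..n}"
  then have "\<epsilon> i * \<delta> i = 1 \<or> \<epsilon> i * \<delta> i = -1"
    using cube_cases[OF assms(1), of i] cube_cases[OF assms(2), of i] by auto
  then show "0 \<le> 1 + \<rho> * of_real (\<epsilon> i * \<delta> i)" using assms(3) by auto
qed

lemma sum_noise_kernel:
  assumes "\<epsilon> \<in> cube n"
  shows "(\<Sum>\<delta>\<in>cube n. noise_kernel n w \<epsilon> \<delta>) = 2 ^ n"
  \<comment> \<open>The kernel with parameter \<open>0\<close> is constantly one.\<close>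
  using sum_noise_kernel_mult[OF assms assms, of w 0] by (simp add: noise_kernel_def)

lemma noise_const: "\<epsilon> \<in> cube n \<Longrightarrow> noise n w (\<lambda>_. c) \<epsilon> = c"
  by (simp add: noise_def sum_noise_kernel flip: sum_distrib_right)

lemma sum_noise: "(\<Sum>\<epsilon>\<in>cube n. noise n w f \<epsilon>) = (\<Sum>\<delta>\<in>cube n. f \<delta>)"
proof -
  have "(\<Sum>\<epsilon>\<in>cube n. noise n w f \<epsilon>) = (\<Sum>\<delta>\<in>cube n. (\<Sum>\<epsilon>\<in>cube n. noise_kernel n w \<delta> \<epsilon>) * f \<delta>) / 2 ^ n"
    unfolding noise_def sum_divide_distrib[symmetric]
    by (subst sum.swap) (simp add: sum_distrib_right noise_kernel_sym)
  then show ?thesis by (simp add: sum_noise_kernel flip: sum_distrib_left)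
qed

lemma noise_mono:
  fixes \<rho> :: real
  assumes "\<epsilon> \<in> cube n" "\<bar>\<rho>\<bar> \<le> 1" "\<And>\<delta>. \<delta> \<in> cube n \<Longrightarrow> f \<delta> \<le> g \<delta>"
  shows "noise n \<rho> f \<epsilon> \<le> noise n \<rho> g \<epsilon>"
  unfolding noise_def using assms
  by (auto intro!: divide_right_mono sum_mono mult_left_mono noise_kernel_nonneg)

text \<open>
  Young's inequality in tangent-line form; it yields both Jensen's and Hoelder's inequality for powers.
\<close>

lemma young_powr:
  fixes m x p :: real
  assumes "1 \<le> p" "0 \<le> m" "0 \<le> x"
  shows "x * m powr (p - 1) \<le> x powr p / p + (1 - 1 / p) * m powr p"
proof (cases "p = 1")
  case True
  then show ?thesis using assms by (cases "m = 0") auto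
next
  case False
  then have p: "1 < p" using assms by simp
  have "x * m powr (p - 1) \<le> x powr p / p + (m powr (p - 1)) powr (p / (p - 1)) / (p / (p - 1))"
    using p assms by (intro Youngs_inequality) (auto simp: field_simps)
  also have "(m powr (p - 1)) powr (p / (p - 1)) = m powr p"
    using p by (simp add: powr_powr)
  also have "m powr p / (p / (p - 1)) = (1 - 1 / p) * m powr p"
    using p by (simp add: field_simps)
  finally show ?thesis .
qed

text \<open>
  Jensen's inequality: the kernel with real parameter is a probability density.
\<close>

lemma noise_powr_le:
  fixes \<rho> :: real
  assumes \<epsilon>: "\<epsilon> \<in> cube n" and \<rho>: "\<bar>\<rho>\<bar> \<le> 1" and g: "\<And>\<delta>. \<delta> \<in> cube n \<Longrightarrow> 0 \<le> g \<delta>" and p: "1 \<le> p"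
  shows "noise n \<rho> g \<epsilon> powr p \<le> noise n \<rho> (\<lambda>\<delta>. g \<delta> powr p) \<epsilon>"
proof -
  define m where "m = noise n \<rho> g \<epsilon>"
  have m: "0 \<le> m"
    using noise_mono[OF \<epsilon> \<rho>, of "\<lambda>_. 0" g] g \<epsilon> by (simp add: m_def noise_const)
  have "noise n \<rho> (\<lambda>\<delta>. m powr (p - 1) * g \<delta>) \<epsilon> \<le>
      noise n \<rho> (\<lambda>\<delta>. 1 / p * g \<delta> powr p + (1 - 1 / p) * m powr p) \<epsilon>"
    using young_powr[OF p m] g by (intro noise_mono[OF \<epsilon> \<rho>]) (simp add: mult.commute)
  then have "m powr (p - 1) * m \<le> 1 / p * noise n \<rho> (\<lambda>\<delta>. g \<delta> powr p) \<epsilon> + (1 - 1 / p) * m powr p"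
    by (simp only: noise_add noise_cmult noise_const[OF \<epsilon>] flip: m_def)
  moreover have "m powr (p - 1) * m = m powr p"
    using powr_add[of m "p - 1" 1] m by (cases "m = 0") auto
  ultimately have "1 / p * m powr p \<le> 1 / p * noise n \<rho> (\<lambda>\<delta>. g \<delta> powr p) \<epsilon>"
    by (simp add: algebra_simps)
  then show ?thesis using p by (simp add: m_def divide_le_cancel)
qed

lemma norm_noise_le:
  fixes f :: "(nat \<Rightarrow> real) \<Rightarrow> complex"
  assumes "\<epsilon> \<in> cube n" "\<bar>\<rho>\<bar> \<le> 1"
  shows "cmod (noise n (of_real \<rho>) f \<epsilon>) \<le> noise n \<rho> (\<lambda>\<delta>. cmod (f \<delta>)) \<epsilon>"
proof -
  have "cmod (noise_kernel n (of_real \<rho>) \<epsilon> \<delta> * f \<delta>) = noise_kernel n \<rho> \<epsilon> \<delta> * cmod (f \<delta>)"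
    if "\<delta> \<in> cube n" for \<delta>
  proof -
    have "noise_kernel n (of_real \<rho>) \<epsilon> \<delta> = complex_of_real (noise_kernel n \<rho> \<epsilon> \<delta>)"
      by (simp add: noise_kernel_def)
    then show ?thesis using noise_kernel_nonneg[OF assms(1) that assms(2)] by (simp add: norm_mult)
  qed
  then have "cmod (\<Sum>\<delta>\<in>cube n. noise_kernel n (of_real \<rho>) \<epsilon> \<delta> * f \<delta>) \<le>
      (\<Sum>\<delta>\<in>cube n. noise_kernel n \<rho> \<epsilon> \<delta> * cmod (f \<delta>))"
    by (intro order_trans[OF norm_sum] eq_refl sum.cong) auto
  then show ?thesis by (simp add: noise_def norm_divide norm_power divide_right_mono)
qed

lemma L2_set_sum_le:
  assumes "finite A"
  shows "L2_set (\<lambda>i. \<Sum>x\<in>A. h x i) I \<le> (\<Sum>x\<in>A. L2_set (h x) I)"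
  using assms
proof (induction A rule: finite_induct)
  case (insert x A)
  have "L2_set (\<lambda>i. h x i + (\<Sum>x\<in>A. h x i)) I \<le> L2_set (h x) I + L2_set (\<lambda>i. \<Sum>x\<in>A. h x i) I"
    by (rule L2_set_triangle_ineq)
  then show ?case using insert by simp
qed (simp add: L2_set_def)

lemma grad_length_L2_set: "grad_length n f \<epsilon> = L2_set (\<lambda>i. cmod (cube_partial i f \<epsilon>)) {1..n}"
  by (simp add: grad_length_def L2_set_def)

lemma grad_length_nonneg [simp]: "0 \<le> grad_length n f \<epsilon>"
  by (simp add: grad_length_L2_set)

lemma grad_length_cong:
  assumes "\<epsilon> \<in> cube n" "\<And>\<delta>. \<delta> \<in> cube n \<Longrightarrow> f \<delta> = g \<delta>"
  shows "grad_length n f \<epsilon> = grad_length n g \<epsilon>"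
proof -
  have "cube_partial i f \<epsilon> = cube_partial i g \<epsilon>" if "i \<in> {1..n}" for i
    using assms flip_in_cube[OF assms(1) that] by (simp add: cube_partial_def)
  then show ?thesis by (simp add: grad_length_def)
qed

text \<open>
  Each partial derivative commutes with the noise, and the triangle inequality in the Euclidean norm moves
  the averaging outside.
\<close>

lemma grad_length_noise_le:
  assumes \<epsilon>: "\<epsilon> \<in> cube n" and \<rho>: "\<bar>\<rho>\<bar> \<le> 1"
  shows "grad_length n (noise n (of_real \<rho>) f) \<epsilon> \<le> noise n \<rho> (grad_length n f) \<epsilon>"
proof -
  have "grad_length n (noise n (of_real \<rho>) f) \<epsilon> \<le>
      L2_set (\<lambda>i. \<Sum>\<delta>\<in>cube n. noise_kernel n \<rho> \<epsilon> \<delta> / 2 ^ n * cmod (cube_partial i f \<delta>)) {1..n}"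
    unfolding grad_length_L2_set
  proof (rule L2_set_mono)
    fix i assume "i \<in> {1..n}"
    then show "cmod (cube_partial i (noise n (of_real \<rho>) f) \<epsilon>) \<le>
        (\<Sum>\<delta>\<in>cube n. noise_kernel n \<rho> \<epsilon> \<delta> / 2 ^ n * cmod (cube_partial i f \<delta>))"
      using norm_noise_le[OF assms, of "cube_partial i f"]
      by (simp add: cube_partial_noise noise_def sum_divide_distrib)
  qed simp
  also have "\<dots> \<le> (\<Sum>\<delta>\<in>cube n. L2_set (\<lambda>i. noise_kernel n \<rho> \<epsilon> \<delta> / 2 ^ n * cmod (cube_partial i f \<delta>)) {1..n})"
    by (rule L2_set_sum_le) simp
  also have "\<dots> = (\<Sum>\<delta>\<in>cube n. noise_kernel n \<rho> \<epsilon> \<delta> / 2 ^ n * grad_length n f \<delta>)"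
    unfolding grad_length_L2_set using noise_kernel_nonneg[OF \<epsilon> _ \<rho>]
    by (intro sum.cong refl L2_set_right_distrib[symmetric] divide_nonneg_nonneg) auto
  also have "\<dots> = noise n \<rho> (grad_length n f) \<epsilon>"
    by (simp add: noise_def sum_divide_distrib)
  finally show ?thesis .
qed

lemma sum_grad_length_noise_le:
  assumes \<rho>: "\<bar>\<rho>\<bar> \<le> 1" and p: "1 \<le> p"
  shows "(\<Sum>\<epsilon>\<in>cube n. grad_length n (noise n (of_real \<rho>) f) \<epsilon> powr p) \<le> (\<Sum>\<epsilon>\<in>cube n. grad_length n f \<epsilon> powr p)"
proof -
  have "(\<Sum>\<epsilon>\<in>cube n. grad_length n (noise n (of_real \<rho>) f) \<epsilon> powr p) \<le>
      (\<Sum>\<epsilon>\<in>cube n. noise n \<rho> (\<lambda>\<delta>. grad_length n f \<delta> powr p) \<epsilon>)"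
  proof (rule sum_mono)
    fix \<epsilon> assume \<epsilon>: "\<epsilon> \<in> cube n"
    have "grad_length n (noise n (of_real \<rho>) f) \<epsilon> powr p \<le> noise n \<rho> (grad_length n f) \<epsilon> powr p"
      using p by (intro powr_mono2 grad_length_noise_le[OF \<epsilon> \<rho>]) auto
    also have "\<dots> \<le> noise n \<rho> (\<lambda>\<delta>. grad_length n f \<delta> powr p) \<epsilon>"
      by (rule noise_powr_le[OF \<epsilon> \<rho> _ p]) simp
    finally show "grad_length n (noise n (of_real \<rho>) f) \<epsilon> powr p \<le> \<dots>" .
  qed
  then show ?thesis by (simp add: sum_noise)
qed

section \<open>Contractivity of complex noise in a sector\<close>

text \<open>
  Since \<open>p > 1\<close> this also holds at zeros of \<open>u\<close>, where the difference quotient is at most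
  \<open>cmod (u x) powr (p - 1)\<close> times a bounded quantity.
\<close>

lemma norm_powr_has_real_derivative:
  fixes u :: "real \<Rightarrow> complex"
  assumes p: "1 < p" and u: "(u has_vector_derivative u') (at r)"
  shows "((\<lambda>r. cmod (u r) powr p) has_real_derivative p * Re (u' * cnj (duality_map p (u r)))) (at r)"
proof (cases "u r = 0")
  case False
  have "((\<lambda>r. cmod (u r)) has_derivative (\<lambda>h. h *\<^sub>R u' \<bullet> sgn (u r))) (at r)"
    using has_derivative_compose[where g = cmod and g' = "\<lambda>h. h \<bullet> sgn (u r)", OF
        u[unfolded has_vector_derivative_def] has_derivative_norm[OF False]] .
  then have 1: "((\<lambda>r. cmod (u r)) has_real_derivative (u' \<bullet> sgn (u r))) (at r)"
    by (rule has_derivative_imp_has_field_derivative) simp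
  have 2: "((\<lambda>r. cmod (u r) powr p) has_real_derivative
      (p * cmod (u r) powr (p - 1)) * (u' \<bullet> sgn (u r))) (at r)"
    using DERIV_fun_powr[OF 1, of p] False by (simp add: mult_ac)
  have "Re (u' * cnj (duality_map p (u r))) = cmod (u r) powr (p - 2) * (u' \<bullet> u r)"
    by (simp add: duality_map_def inner_complex_def algebra_simps)
  also have "\<dots> = cmod (u r) powr (p - 1) * (u' \<bullet> sgn (u r))"
    using False by (simp add: sgn_div_norm powr_diff divide_simps)
      (simp add: power2_eq_square)
  finally show ?thesis using 2 by (simp add: mult.assoc)
next
  case True
  have "((\<lambda>x. (cmod (u x) powr p - cmod (u r) powr p) / (x - r)) \<longlongrightarrow> 0) (at r)"
  proof (rule Lim_null_comparison)
    define q where "q = (\<lambda>x. (u x - u r - (x - r) *\<^sub>R u') /\<^sub>R \<bar>x - r\<bar>)"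
    have lim: "(q \<longlongrightarrow> 0) (at r)"
      using u by (simp add: has_vector_derivative_def has_derivative_at_within q_def)
    have "(u \<longlongrightarrow> 0) (at r)"
      using has_vector_derivative_continuous[OF u] True by (simp add: continuous_at)
    then have pw: "((\<lambda>x. cmod (u x) powr (p - 1)) \<longlongrightarrow> 0 powr (p - 1)) (at r)"
      using p by (intro tendsto_powr2 tendsto_norm_zero) auto
    then show "((\<lambda>x. cmod (u x) powr (p - 1) * (cmod (q x) + cmod u')) \<longlongrightarrow> 0) (at r)"
      using tendsto_mult[OF pw tendsto_add[OF tendsto_norm[OF lim] tendsto_const[of "cmod u'"]]] p
      by simp
    show "\<forall>\<^sub>F x in at r. norm ((cmod (u x) powr p - cmod (u r) powr p) / (x - r))
        \<le> cmod (u x) powr (p - 1) * (cmod (q x) + cmod u')"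
    proof (intro always_eventually allI)
      fix x
      have "cmod (u x) powr p = cmod (u x) powr (p - 1) * cmod (u x)"
        using powr_add[of "cmod (u x)" "p - 1" 1] by (cases "u x = 0") auto
      moreover have quot: "cmod (u x) / \<bar>x - r\<bar> \<le> cmod (q x) + cmod u'"
      proof (cases "x = r")
        case False
        have "u x = \<bar>x - r\<bar> *\<^sub>R q x + (x - r) *\<^sub>R u'"
          using False True by (simp add: q_def)
        then have "cmod (u x) \<le> \<bar>x - r\<bar> * cmod (q x) + \<bar>x - r\<bar> * cmod u'"
          using norm_triangle_ineq[of "\<bar>x - r\<bar> *\<^sub>R q x" "(x - r) *\<^sub>R u'"] by simp
        also have "\<dots> = \<bar>x - r\<bar> * (cmod (q x) + cmod u')" by (simp add: algebra_simps)
        finally show ?thesis using False by (simp add: divide_le_eq mult.commute)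
      qed simp
      ultimately show "norm ((cmod (u x) powr p - cmod (u r) powr p) / (x - r))
        \<le> cmod (u x) powr (p - 1) * (cmod (q x) + cmod u')"
        using True p quot mult_left_mono[OF quot, of "cmod (u x) powr (p - 1)"]
        by (simp add: abs_mult)
    qed
  qed
  then show ?thesis using True by (simp add: has_field_derivative_iff duality_map_def)
qed

text \<open>
  Integration by parts on the cube: flipping coordinate \<open>i\<close> changes the sign of the \<open>i\<close>-th partial
  derivative and preserves the sum over the cube, so each term equals its average with its flipped copy.
\<close>

lemma sum_cube_partial_duality_map:
  "(\<Sum>\<epsilon>\<in>cube n. (\<Sum>i=1..n. cube_partial i u \<epsilon>) * cnj (duality_map p (u \<epsilon>))) =
    (\<Sum>\<epsilon>\<in>cube n. \<Sum>i=1..n. two_point_form p (u \<epsilon>) (u (\<epsilon>(i := - \<epsilon> i)))) / 4"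
proof -
  have "(\<Sum>\<epsilon>\<in>cube n. cube_partial i u \<epsilon> * cnj (duality_map p (u \<epsilon>))) =
      (\<Sum>\<epsilon>\<in>cube n. two_point_form p (u \<epsilon>) (u (\<epsilon>(i := - \<epsilon> i)))) / 4" if "i \<in> {1..n}" for i
  proof -
    define S where "S = (\<Sum>\<epsilon>\<in>cube n. cube_partial i u \<epsilon> * cnj (duality_map p (u \<epsilon>)))"
    have "S = (\<Sum>\<epsilon>\<in>cube n. - cube_partial i u \<epsilon> * cnj (duality_map p (u (\<epsilon>(i := - \<epsilon> i)))))"
      unfolding S_def
      by (subst sum_cube_flip[OF that, symmetric])
        (auto intro!: sum.cong simp: cube_partial_def algebra_simps diff_divide_distrib)
    then have "2 * S = (\<Sum>\<epsilon>\<in>cube n. cube_partial i u \<epsilon> * cnj (duality_map p (u \<epsilon>))) +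
        (\<Sum>\<epsilon>\<in>cube n. - cube_partial i u \<epsilon> * cnj (duality_map p (u (\<epsilon>(i := - \<epsilon> i)))))"
      by (simp flip: S_def)
    also have "\<dots> = (\<Sum>\<epsilon>\<in>cube n. two_point_form p (u \<epsilon>) (u (\<epsilon>(i := - \<epsilon> i))) / 2)"
      unfolding sum.distrib[symmetric]
      by (intro sum.cong refl) (simp add: cube_partial_def two_point_form_def algebra_simps diff_divide_distrib add_divide_distrib)
    finally show ?thesis by (simp add: S_def mult.commute flip: sum_divide_distrib)
  qed
  then have "(\<Sum>i=1..n. \<Sum>\<epsilon>\<in>cube n. cube_partial i u \<epsilon> * cnj (duality_map p (u \<epsilon>))) =
      (\<Sum>i=1..n. (\<Sum>\<epsilon>\<in>cube n. two_point_form p (u \<epsilon>) (u (\<epsilon>(i := - \<epsilon> i)))) / 4)"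
    by (intro sum.cong) auto
  then show ?thesis
    unfolding sum_divide_distrib[symmetric] sum_distrib_right
    by (subst (asm) (1 2) sum.swap)
qed

lemma sum_norm_noise_has_real_derivative:
  fixes f :: "(nat \<Rightarrow> real) \<Rightarrow> complex" and z :: complex and n :: nat
  assumes p: "1 < p"
  defines "u \<equiv> \<lambda>r. noise n (exp (- (of_real r * z))) f"
  shows "((\<lambda>r. \<Sum>\<epsilon>\<in>cube n. cmod (u r \<epsilon>) powr p) has_real_derivative
    - (p / 4) * (\<Sum>\<epsilon>\<in>cube n. \<Sum>i=1..n. Re (z * two_point_form p (u r \<epsilon>) (u r (\<epsilon>(i := - \<epsilon> i)))))) (at r)"
proof -
  have "((\<lambda>r. \<Sum>\<epsilon>\<in>cube n. cmod (u r \<epsilon>) powr p) has_real_derivative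
      (\<Sum>\<epsilon>\<in>cube n. p * Re (- z * (\<Sum>i=1..n. cube_partial i (u r) \<epsilon>) * cnj (duality_map p (u r \<epsilon>))))) (at r)"
    unfolding u_def by (intro DERIV_sum norm_powr_has_real_derivative p noise_has_vector_derivative)
  also have "(\<Sum>\<epsilon>\<in>cube n. p * Re (- z * (\<Sum>i=1..n. cube_partial i (u r) \<epsilon>) * cnj (duality_map p (u r \<epsilon>)))) =
      - p * Re (z * (\<Sum>\<epsilon>\<in>cube n. (\<Sum>i=1..n. cube_partial i (u r) \<epsilon>) * cnj (duality_map p (u r \<epsilon>))))"
  proof -
    have "p * Re (- z * a * b) = - p * Re (z * (a * b))" for a b
      by (simp only: mult.assoc mult_minus_left mult_minus_right uminus_complex.simps)
    then show ?thesis by (simp only: sum_distrib_left[of z] sum_distrib_left[of "- p"] Re_sum)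
  qed
  also have "\<dots> = - (p / 4) * (\<Sum>\<epsilon>\<in>cube n. \<Sum>i=1..n. Re (z * two_point_form p (u r \<epsilon>) (u r (\<epsilon>(i := - \<epsilon> i)))))"
  proof -
    have "- p * Re (a / 4) = - (p / 4) * Re a" for a by simp
    then show ?thesis
      unfolding sum_cube_partial_duality_map times_divide_eq_right
      by (simp only: sum_distrib_left[of z] Re_sum)
  qed
  finally show ?thesis .
qed

text \<open>
  The condition on \<open>z\<close> describes the sector \<open>\<bar>Arg z\<bar> \<le> theta p / 2\<close>; along each ray in it every term of the
  dissipation is nonnegative.
\<close>

lemma sum_norm_noise_sector_le:
  fixes f :: "(nat \<Rightarrow> real) \<Rightarrow> complex"
  assumes p: "1 < p" and z: "\<bar>p - 2\<bar> * \<bar>Im z\<bar> \<le> 2 * sqrt (p - 1) * Re z"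
  shows "(\<Sum>\<epsilon>\<in>cube n. cmod (noise n (exp (- z)) f \<epsilon>) powr p) \<le> (\<Sum>\<epsilon>\<in>cube n. cmod (f \<epsilon>) powr p)"
proof -
  define h where "h = (\<lambda>r::real. \<Sum>\<epsilon>\<in>cube n. cmod (noise n (exp (- (of_real r * z))) f \<epsilon>) powr p)"
  have "h 1 \<le> h 0"
  proof (rule DERIV_nonpos_imp_nonincreasing[of 0 1 h])
    fix r :: real
    show "\<exists>D. (h has_real_derivative D) (at r) \<and> D \<le> 0"
      unfolding h_def
      by (intro exI conjI, rule sum_norm_noise_has_real_derivative[OF p])
        (use p Re_two_point_form_nonneg[OF p z] in \<open>auto intro!: mult_nonneg_nonneg sum_nonneg\<close>)
  qed simp
  then show ?thesis by (simp add: h_def noise_one)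
qed

section \<open>Polynomials at an exterior point near a corner\<close>

text \<open>
  Bernstein's growth estimate: the reversed polynomial \<open>v ^ d * P (r / v)\<close> is a polynomial in \<open>v\<close>, to which
  the maximum principle in the unit disc applies.
\<close>

lemma polynomial_growth_outside_disc:
  fixes c :: "nat \<Rightarrow> complex" and d :: nat
  defines "P \<equiv> \<lambda>w. \<Sum>k\<le>d. c k * w ^ k"
  assumes r: "0 < r" and bound: "\<And>w. cmod w = r \<Longrightarrow> cmod (P w) \<le> N"
    and w: "r \<le> cmod w"
  shows "cmod (P w) \<le> N * (cmod w / r) ^ d"
proof -
  define Q where "Q \<equiv> \<lambda>v. \<Sum>k\<le>d. c k * of_real r ^ k * v ^ (d - k)"
  have PQ: "P u = (u / of_real r) ^ d * Q (of_real r / u)" if "u \<noteq> 0" for u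
    unfolding P_def Q_def sum_distrib_left
  proof (rule sum.cong[OF refl])
    fix k assume "k \<in> {..d}"
    then have d: "d = k + (d - k)" by simp
    have "(u / of_real r) ^ d = (u / of_real r) ^ k * (u / of_real r) ^ (d - k)"
      by (metis d power_add)
    then show "c k * u ^ k =
        (u / of_real r) ^ d * (c k * of_real r ^ k * (of_real r / u) ^ (d - k))"
      using that r by (simp add: field_simps)
  qed
  have "cmod (Q (of_real r / w)) \<le> N"
  proof (rule maximum_modulus_frontier[where S = "cball 0 1" and f = Q])
    show "of_real r / w \<in> cball (0::complex) 1"
      using r w by (auto simp: norm_divide divide_le_eq)
    fix v :: complex assume "v \<in> frontier (cball 0 1)"
    then have v: "cmod v = 1" by simp
    then have v0: "v \<noteq> 0" by auto
    have "P (of_real r / v) = (1 / v) ^ d * Q v"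
      using PQ[of "of_real r / v"] r v0 by simp
    then have "cmod (P (of_real r / v)) = cmod (Q v)"
      by (simp add: norm_mult norm_power norm_divide v)
    then show "cmod (Q v) \<le> N"
      using bound[of "of_real r / v"] r v by (simp add: norm_divide)
  qed (auto simp: Q_def intro!: holomorphic_intros continuous_intros)
  moreover have "w \<noteq> 0" using r w by auto
  ultimately show ?thesis
    using r by (simp add: PQ norm_mult norm_power norm_divide mult.commute mult_left_mono)
qed

text \<open>
  Jordan's inequality \<open>2 / pi * x \<le> sin x\<close>, read at the complementary angle.
\<close>

lemma angle_deficit_le_cos:
  fixes a :: real
  assumes "0 \<le> a" "a \<le> pi / 2"
  shows "pi / 2 - a \<le> pi / 2 * cos a"
proof -
  have "concave_on {0..pi/2} cos"
    unfolding concave_on_def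
  proof (rule f''_ge0_imp_convex)
    fix x :: real assume "x \<in> {0..pi/2}"
    show "((\<lambda>x. - cos x) has_real_derivative sin x) (at x)"
      "(sin has_real_derivative cos x) (at x)"
      by (auto intro!: derivative_eq_intros)
    show "0 \<le> cos x" using \<open>x \<in> {0..pi/2}\<close> by (intro cos_ge_zero) auto
  qed auto
  from concave_onD[OF this, of "a / (pi/2)" 0 "pi/2"] assms
  have "(1 - a / (pi/2)) * cos 0 + (a / (pi/2)) * cos (pi/2) \<le> cos ((1 - a / (pi/2)) *\<^sub>R 0 + (a / (pi/2)) *\<^sub>R (pi/2))"
    by (auto simp: field_simps)
  then have "1 - 2 * a / pi \<le> cos a" by (simp add: field_simps)
  then have "pi / 2 * (1 - 2 * a / pi) \<le> pi / 2 * cos a"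
    by (intro mult_left_mono) auto
  then show ?thesis by (simp add: right_diff_distrib)
qed

text \<open>
  The polynomial is bounded at \<open>exp (- z)\<close> and \<open>- exp (- z)\<close> for \<open>z\<close> in the sector of half-angle \<open>\<phi>\<close>. The
  substitution \<open>z = - (s powr \<beta>)\<close> carries the right half-plane to the complement of this sector, and
  \<open>g s = P (exp (s powr \<beta>)) * exp (- K * d * s)\<close> is bounded by \<open>N\<close> on the half-disc \<open>S\<close>: on the
  diameter because \<open>z\<close> is on the boundary of the sector, and on the arc by the following comparison. The two
  copies of the sector, taken modulo the period of the exponential, cover the half-plane \<open>x0 \<le> Re z\<close>, so
  \<open>P\<close> is bounded on the disc of radius \<open>exp (- x0)\<close>, and Bernstein's estimate bounds it by
  \<open>N * exp (d * (x0 - Re z))\<close> outside. The radius is chosen so that the arc meets the sector exactly on the line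
  \<open>Re z = x0\<close>; hence the exponent vanishes at the ends of the arc, and it is dominated there by the linear
  function \<open>K * d * Re s\<close>.
\<close>

lemma polynomial_bound_outside_spiral_corner:
  fixes c :: "nat \<Rightarrow> complex" and d :: nat
  defines "P \<equiv> \<lambda>w. \<Sum>k\<le>d. c k * w ^ k"
  assumes \<phi>: "0 < \<phi>" "\<phi> \<le> pi / 2" and \<beta>: "\<beta> = 2 - 2 * \<phi> / pi"
    and d: "1 \<le> d"
    and bound: "\<And>z. \<bar>Im z\<bar> * cos \<phi> \<le> Re z * sin \<phi> \<Longrightarrow> cmod (P (exp (- z))) \<le> N"
    and bound': "\<And>z. \<bar>Im z\<bar> * cos \<phi> \<le> Re z * sin \<phi> \<Longrightarrow> cmod (P (- exp (- z))) \<le> N"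
  shows "cmod (P (of_real (exp (real d powr - \<beta>)))) \<le>
           N * exp (pi / (2 * sin \<phi>) * \<beta> * pi / 2)"
proof -
  define R where "R = pi / (2 * sin \<phi>)"
  define x0 where "x0 = R * cos \<phi>"
  define \<rho> where "\<rho> = R powr (1 / \<beta>)"
  define K where "K = R * \<beta> * pi / 2"
  have sin: "0 < sin \<phi>" "sin \<phi> \<le> 1" using \<phi> by (auto intro!: sin_gt_zero)
  have cos: "0 \<le> cos \<phi>" using \<phi> by (intro cos_ge_zero) auto
  have R1: "1 \<le> R"
    using sin pi_ge_two by (simp add: R_def le_divide_eq order_trans[of "2 * sin \<phi>" 2])
  have \<beta>1: "1 \<le> \<beta>" "\<beta> < 2" using \<phi> pi_gt_zero by (auto simp: \<beta> field_simps)
  have \<beta>\<phi>: "\<beta> * (pi / 2) = pi - \<phi>" by (simp add: \<beta> field_simps)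
  have \<rho>1: "1 \<le> \<rho>" using R1 \<beta>1 by (auto simp: \<rho>_def intro!: ge_one_powr_ge_zero)
  have \<rho>R: "\<rho> powr \<beta> = R" using \<beta>1 R1 by (simp add: \<rho>_def powr_powr)
  have N: "0 \<le> N" using bound[of 0] order_trans[OF norm_ge_zero] by fastforce
  have K: "0 \<le> K" using R1 \<beta>1 by (simp add: K_def)
  have Pcont: "continuous_on A P" for A unfolding P_def by (intro continuous_intros)
  \<comment> \<open>Up to a sign, \<open>w = exp (- z)\<close> with \<open>Re z = x0\<close> and \<open>\<bar>Im z\<bar> \<le> pi / 2\<close>, and \<open>R * sin \<phi> = pi / 2\<close>
    puts this segment into the sector.\<close>
  have circle: "cmod (P w) \<le> N" if w: "cmod w = exp (- x0)" for w
  proof -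
    have *: "\<exists>z. \<bar>Im z\<bar> * cos \<phi> \<le> Re z * sin \<phi> \<and> w' = exp (- z)"
      if "0 \<le> Re w'" "cmod w' = exp (- x0)" for w'
    proof -
      have "\<bar>Arg w'\<bar> \<le> pi / 2" using that(1) by (simp only: Arg_Re_nonneg)
      then have "\<bar>Arg w'\<bar> * cos \<phi> \<le> pi / 2 * cos \<phi>" using cos by (rule mult_right_mono)
      also have "pi / 2 * cos \<phi> = x0 * sin \<phi>" using sin by (simp add: x0_def R_def)
      finally have "\<bar>Im (Complex x0 (- Arg w'))\<bar> * cos \<phi> \<le> Re (Complex x0 (- Arg w')) * sin \<phi>"
        by simp
      moreover have "w' = exp (- Complex x0 (- Arg w'))"
      proof -
        have "w' \<noteq> 0" using that by auto
        then have "w' = of_real (cmod w') * exp (\<i> * of_real (Arg w'))"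
          by (rule Arg_eq)
        also have "of_real (cmod w') = exp (complex_of_real (- x0))"
          unfolding that(2) by (simp only: exp_of_real)
        also have "exp (complex_of_real (- x0)) * exp (\<i> * of_real (Arg w'))
            = exp (- Complex x0 (- Arg w'))"
          by (simp add: Complex_eq flip: exp_add)
        finally show ?thesis .
      qed
      ultimately show ?thesis by blast
    qed
    show ?thesis
    proof (cases "0 \<le> Re w")
      case True
      then show ?thesis using *[of w] w bound by blast
    next
      case False
      then obtain z where "\<bar>Im z\<bar> * cos \<phi> \<le> Re z * sin \<phi>" "- w = exp (- z)"
        using *[of "- w"] w by auto
      then show ?thesis using bound'[of z] by (metis minus_minus)
    qed
  qed
  define g where "g = (\<lambda>s. P (exp (s powr of_real \<beta>)) * exp (- of_real (K * d) * s))"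
  define S where "S = cball 0 \<rho> \<inter> {s. 0 \<le> Re s}"
  have "cmod (g (1 / of_nat d)) \<le> N"
  proof (rule maximum_modulus_frontier[where S = S and f = g])
    have clS: "closed S"
      unfolding S_def by (intro closed_Int closed_halfspace_Re_ge closed_cball)
    show "bounded S" by (auto simp: S_def intro: bounded_Int)
    show "1 / of_nat d \<in> S" using d \<rho>1
      by (auto simp: S_def norm_divide divide_le_eq Re_divide_of_nat intro: order_trans)
    have intS: "interior S = ball 0 \<rho> \<inter> {s. 0 < Re s}"
      using interior_halfspace_ge[of "1::complex" 0]
      by (simp add: S_def inner_complex_def)
    show "g holomorphic_on interior S"
      unfolding g_def P_def intS
      by (auto intro!: holomorphic_intros simp: complex_nonpos_Reals_iff)
    show "continuous_on (closure S) g"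
      unfolding g_def using \<beta>1 unfolding closure_closed[OF clS]
      by (auto intro!: continuous_intros continuous_on_compose2[OF Pcont]
          simp: S_def)
    fix s assume "s \<in> frontier S"
    then have s: "cmod s \<le> \<rho>" "0 \<le> Re s" "Re s = 0 \<or> cmod s = \<rho>"
      using clS by (auto simp: frontier_def intS closure_closed, auto simp: S_def)
    consider "s = 0" | "s \<noteq> 0" "Re s = 0" | "s \<noteq> 0" "cmod s = \<rho>" using s by blast
    then show "cmod (g s) \<le> N"
    proof cases
      case 1
      then show ?thesis using bound[of 0] by (simp add: g_def)
    next
      case 2
      have pow: "s powr of_real \<beta> = of_real (cmod s powr \<beta>) * cis (\<beta> * Arg s)"
        using 2 by (simp add: powr_def Ln_Arg ring_distribs exp_add cis_conv_exp mult_ac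
          flip: exp_of_real)
      have "Arg s = pi / 2 \<or> Arg s = - (pi / 2)"
      proof -
        have "s = \<i> * of_real (Im s)" using 2 by (simp add: complex_eq_iff)
        moreover have "Im s \<noteq> 0" using 2 by (auto simp: complex_eq_iff)
        ultimately show ?thesis
          by (metis Arg_ii Arg_minus_ii Arg_times_of_real2 Arg_times_of_real
              linorder_neqE_linordered_idom mult.commute mult_minus_left mult_minus_right
              neg_0_less_iff_less of_real_minus minus_minus minus_divide_left)
      qed
      then have a: "\<beta> * Arg s = pi - \<phi> \<or> \<beta> * Arg s = - (pi - \<phi>)"
        using \<beta>\<phi> by (metis mult_minus_right)
      define z where "z = - (s powr of_real \<beta>)"
      have "\<bar>Im z\<bar> * cos \<phi> \<le> Re z * sin \<phi>"
        using a sin by (auto simp: z_def pow abs_mult cos_minus)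
      from bound[OF this] have "cmod (P (exp (s powr of_real \<beta>))) \<le> N"
        by (simp add: z_def)
      then show ?thesis using 2 by (simp add: g_def norm_mult)
    next
      case 3
      have "s powr of_real \<beta> = of_real (cmod s powr \<beta>) * cis (\<beta> * Arg s)"
        using 3(1) by (simp add: powr_def Ln_Arg ring_distribs exp_add cis_conv_exp mult_ac
          flip: exp_of_real)
      then have pow: "s powr of_real \<beta> = of_real R * cis (\<beta> * Arg s)"
        using 3 \<rho>R by simp
      define a where "a = \<bar>Arg s\<bar>"
      have a: "0 \<le> a" "a \<le> pi / 2" unfolding a_def using s(2) by (simp, simp only: Arg_Re_nonneg)
      have "Re s = cmod s * cos (Arg s)" using 3 by (metis Arg_eq Re_complex_of_real Re_rcis cis_conv_exp rcis_def)
      then have Res: "Re s = \<rho> * cos a" using 3 by (simp add: a_def)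
      have Repow: "Re (s powr of_real \<beta>) = R * cos (\<beta> * a)"
        using \<beta>1 by (simp add: pow a_def abs_if)
      have ba: "\<beta> * a \<le> \<beta> * (pi / 2)" using a \<beta>1 by (intro mult_left_mono) auto
      have cosp: "cos \<phi> = - cos (\<beta> * (pi / 2))" unfolding \<beta>\<phi> by simp
      have "cos (\<beta> * (pi / 2)) \<le> cos (\<beta> * a)"
        using ba a(1) \<beta>1(1) \<phi>(1) unfolding \<beta>\<phi> by (intro cos_monotone_0_pi_le) auto
      then have low: "- x0 \<le> R * cos (\<beta> * a)"
        using R1 by (simp add: x0_def cosp)
      have "cos (\<beta> * a) - cos (\<beta> * (pi / 2)) \<le> \<beta> * (pi / 2) - \<beta> * a"
      proof (cases "\<beta> * a = \<beta> * (pi / 2)")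
        case False
        then have "\<beta> * a < \<beta> * (pi / 2)" using ba by linarith
        from MVT2[OF this, of cos "\<lambda>x. - sin x"] obtain x where
          "cos (\<beta> * (pi / 2)) - cos (\<beta> * a) = (\<beta> * (pi / 2) - \<beta> * a) * - sin x"
          by (auto intro: derivative_eq_intros)
        moreover have "(\<beta> * (pi / 2) - \<beta> * a) * sin x \<le> (\<beta> * (pi / 2) - \<beta> * a) * 1"
          using ba by (intro mult_left_mono) auto
        ultimately show ?thesis by simp
      qed (simp only: diff_self order_refl)
      also have "\<dots> = \<beta> * (pi / 2 - a)" by (simp add: algebra_simps)
      also have "\<dots> \<le> \<beta> * (pi / 2 * cos a)"
        using \<beta>1 angle_deficit_le_cos[OF a] by (intro mult_left_mono) auto
      finally have "R * (cos (\<beta> * a) + cos \<phi>) \<le> R * (\<beta> * (pi / 2 * cos a))"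
        using R1 by (intro mult_left_mono) (auto simp: cosp)
      also have "\<dots> = K * cos a" by (simp add: K_def)
      also have "\<dots> \<le> K * Re s"
        using K \<rho>1 a cos_ge_zero[of a] unfolding Res
        by (intro mult_left_mono) (auto simp: mult_le_cancel_right1)
      \<comment> \<open>The Lipschitz bound for the cosine and Jordan's inequality make both sides vanish to first
        order at the ends of the arc.\<close>
      finally have key: "R * cos (\<beta> * a) + x0 \<le> K * Re s" by (simp add: x0_def algebra_simps)
      have "cmod (P (exp (s powr of_real \<beta>))) \<le> N * (cmod (exp (s powr of_real \<beta>)) / exp (- x0)) ^ d"
        unfolding P_def
        by (rule polynomial_growth_outside_disc) (use circle low Repow in \<open>auto simp: P_def\<close>)
      also have "cmod (exp (s powr of_real \<beta>)) / exp (- x0) = exp (R * cos (\<beta> * a) + x0)"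
        by (simp add: Repow exp_add exp_minus divide_simps)
      also have "\<dots> ^ d \<le> exp (K * Re s) ^ d"
        using key by (intro power_mono) auto
      also have "\<dots> = exp (K * d * Re s)" by (simp add: mult_ac flip: exp_of_nat_mult)
      finally have "cmod (P (exp (s powr of_real \<beta>))) \<le> N * exp (K * d * Re s)"
        using N by (simp add: mult_left_mono)
      then have "cmod (g s) \<le> (N * exp (K * d * Re s)) * exp (- (K * d * Re s))"
        unfolding g_def norm_mult by (intro mult_mono) (use N in auto)
      also have "\<dots> = N" by (simp add: exp_minus)
      finally show ?thesis .
    qed
  qed
  moreover have "(1 / of_nat d :: complex) powr of_real \<beta> = of_real (real d powr - \<beta>)"
  proof -
    have "(1 / of_nat d :: complex) powr of_real \<beta> = of_real ((1 / real d) powr \<beta>)"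
      using powr_of_real[of "1 / real d" \<beta>] by simp
    then show ?thesis using d by (simp add: powr_minus powr_divide inverse_eq_divide)
  qed
  moreover have "cmod (exp (- of_real (K * d) * (1 / of_nat d))) = exp (- K)"
    using d by (simp add: )
  ultimately have "cmod (P (of_real (exp (real d powr - \<beta>)))) * exp (- K) \<le> N"
    by (simp add: g_def norm_mult exp_of_real)
  then show ?thesis by (simp add: exp_minus field_simps K_def R_def)
qed

section \<open>Inverting the noise on functions of low degree\<close>

text \<open>
  Hoelder's inequality, with the second function already raised to the power of the dual exponent.
\<close>

lemma sum_mult_powr_le:
  fixes x y :: "'a \<Rightarrow> real"
  assumes fin: "finite I" and p: "1 < p" and x: "\<And>i. i \<in> I \<Longrightarrow> 0 \<le> x i" and y: "\<And>i. i \<in> I \<Longrightarrow> 0 \<le> y i"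
  shows "(\<Sum>i\<in>I. x i * y i powr (p - 1)) \<le>
    (\<Sum>i\<in>I. x i powr p) powr (1 / p) * (\<Sum>i\<in>I. y i powr p) powr ((p - 1) / p)"
proof -
  define X Y where "X = (\<Sum>i\<in>I. x i powr p)" and "Y = (\<Sum>i\<in>I. y i powr p)"
  have XY: "0 \<le> X" "0 \<le> Y" by (auto simp: X_def Y_def intro: sum_nonneg)
  show ?thesis
  proof (cases "X = 0 \<or> Y = 0")
    case True
    then have "\<forall>i\<in>I. x i * y i powr (p - 1) = 0"
      using fin by (auto simp: X_def Y_def sum_nonneg_eq_0_iff)
    then show ?thesis by (simp add: sum.neutral)
  next
    case False
    \<comment> \<open>Dividing by the norms \<open>a\<close> and \<open>b\<close> makes the right side of Young's inequality sum to one.\<close>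
    define a b where "a = X powr (1 / p)" and "b = Y powr (1 / p)"
    have ab: "0 < a" "0 < b" "a powr p = X" "b powr p = Y"
      using False XY p by (auto simp: a_def b_def powr_powr)
    have "(\<Sum>i\<in>I. x i / a * (y i / b) powr (p - 1)) \<le>
        (\<Sum>i\<in>I. (x i / a) powr p / p + (1 - 1 / p) * (y i / b) powr p)"
      using p x y ab by (intro sum_mono young_powr) auto
    also have "\<dots> = (\<Sum>i\<in>I. x i powr p) / X / p + (1 - 1 / p) * ((\<Sum>i\<in>I. y i powr p) / Y)"
      unfolding sum.distrib sum_distrib_left sum_divide_distrib
      using x y ab by (intro arg_cong2[where f = "(+)"] sum.cong refl) (auto simp: powr_divide)
    also have "\<dots> = 1" using False p by (simp add: X_def Y_def)
    also have "(\<Sum>i\<in>I. x i / a * (y i / b) powr (p - 1)) =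
        (\<Sum>i\<in>I. x i * y i powr (p - 1)) / (a * b powr (p - 1))"
      unfolding sum_divide_distrib using y ab by (intro sum.cong refl) (auto simp: powr_divide)
    finally have "(\<Sum>i\<in>I. x i * y i powr (p - 1)) \<le> a * b powr (p - 1)"
      using ab by (simp add: divide_le_eq)
    then show ?thesis by (simp add: a_def b_def X_def Y_def powr_powr)
  qed
qed

text \<open>
  The degree of \<open>f\<close> enters the argument here: it bounds the degree in \<open>w\<close> of the pairing of \<open>noise n w f\<close>
  with any function.
\<close>

lemma noise_pairing_polynomial:
  fixes f g :: "(nat \<Rightarrow> real) \<Rightarrow> complex"
  assumes deg: "degree_at_most n d f"
  obtains c where "\<And>w. (\<Sum>k\<le>d. c k * w ^ k) = (\<Sum>\<epsilon>\<in>cube n. noise n w f \<epsilon> * g \<epsilon>)"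
proof
  define b where "b = (\<lambda>A. walsh_coeff n f A * (\<Sum>\<epsilon>\<in>cube n. walsh A \<epsilon> * g \<epsilon>))"
  define c where "c = (\<lambda>k. \<Sum>A\<in>{A \<in> {A \<in> Pow {1..n}. card A \<le> d}. card A = k}. b A)"
  fix w
  have "(\<Sum>\<epsilon>\<in>cube n. noise n w f \<epsilon> * g \<epsilon>) = (\<Sum>A\<in>Pow {1..n}. b A * w ^ card A)"
    unfolding noise_walsh_expansion sum_distrib_right
    by (subst sum.swap) (simp add: b_def sum_distrib_left sum_distrib_right mult_ac)
  also have "\<dots> = (\<Sum>A\<in>{A \<in> Pow {1..n}. card A \<le> d}. b A * w ^ card A)"
    using deg by (intro sum.mono_neutral_right) (auto simp: b_def degree_at_most_def)
  also have "\<dots> = (\<Sum>k\<le>d. \<Sum>A\<in>{A \<in> {A \<in> Pow {1..n}. card A \<le> d}. card A = k}. b A * w ^ card A)"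
    by (rule sum.group[symmetric]) auto
  also have "\<dots> = (\<Sum>k\<le>d. c k * w ^ k)"
    unfolding c_def sum_distrib_right by (intro sum.cong refl) auto
  finally show "(\<Sum>k\<le>d. c k * w ^ k) = (\<Sum>\<epsilon>\<in>cube n. noise n w f \<epsilon> * g \<epsilon>)" by simp
qed

text \<open>
  Thus \<open>tan (theta p / 2) = 2 * sqrt (p - 1) / \<bar>p - 2\<bar>\<close>, the slope in the sector condition.
\<close>

lemma theta_half:
  assumes "1 < p"
  shows "0 < theta p / 2" "theta p / 2 \<le> pi / 2"
    "sin (theta p / 2) = 2 * sqrt (p - 1) / p" "cos (theta p / 2) = \<bar>p - 2\<bar> / p"
proof -
  define s where "s = 2 * sqrt (p - 1) / p"
  have s2: "s\<^sup>2 = 1 - ((p - 2) / p)\<^sup>2"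
    using assms by (simp add: s_def power_divide power_mult_distrib) (simp add: field_simps power2_eq_square)
  then have "s\<^sup>2 \<le> 1\<^sup>2" by simp
  then have s: "0 < s" "s \<le> 1" using assms power2_le_imp_le[of s 1] by (auto simp: s_def)
  have th: "theta p / 2 = arcsin s" by (simp add: theta_def s_def)
  show "sin (theta p / 2) = 2 * sqrt (p - 1) / p" using s unfolding th by (simp add: s_def)
  show "theta p / 2 \<le> pi / 2" unfolding th using s by (intro arcsin_ubound) auto
  show "0 < theta p / 2" unfolding th using s arcsin_less_arcsin[of 0 s] by simp
  have "cos (arcsin s) = sqrt (1 - s\<^sup>2)" using s by (intro cos_arcsin) auto
  also have "\<dots> = \<bar>p - 2\<bar> / p" using assms by (simp add: s2 real_sqrt_abs abs_divide)
  finally show "cos (theta p / 2) = \<bar>p - 2\<bar> / p" unfolding th .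
qed

text \<open>
  Pair with the functional that norms \<open>g = noise n (exp t) f\<close>. The pairing of \<open>noise n w f\<close> with it is a
  polynomial in \<open>w\<close>, bounded on the spiral region by Hoelder's inequality and contractivity, and its value at
  the exterior point \<open>exp t\<close> is the \<open>p\<close>-th power of the norm of \<open>g\<close>.
\<close>

lemma sum_noise_inverse_le:
  assumes p: "1 < p"
  obtains K where "0 < K" "\<And>n d f. 1 \<le> d \<Longrightarrow> degree_at_most n d f \<Longrightarrow>
    (\<Sum>\<epsilon>\<in>cube n. cmod (noise n (of_real (exp (real d powr - (2 - theta p / pi)))) f \<epsilon>) powr p) \<le>
      K * (\<Sum>\<epsilon>\<in>cube n. cmod (f \<epsilon>) powr p)"
proof
  define \<phi> where "\<phi> = theta p / 2"
  define \<beta> where "\<beta> = 2 - theta p / pi"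
  define k where "k = exp (pi / (2 * sin \<phi>) * \<beta> * pi / 2)"
  show "0 < k powr p" by (simp add: k_def)
  fix n d :: nat and f :: "(nat \<Rightarrow> real) \<Rightarrow> complex"
  assume d: "1 \<le> d" and deg: "degree_at_most n d f"
  define w0 where "w0 = complex_of_real (exp (real d powr - \<beta>))"
  define g where "g = noise n w0 f"
  define A B where "A = (\<Sum>\<epsilon>\<in>cube n. cmod (f \<epsilon>) powr p)" and "B = (\<Sum>\<epsilon>\<in>cube n. cmod (g \<epsilon>) powr p)"
  have AB: "0 \<le> A" "0 \<le> B" by (auto simp: A_def B_def intro: sum_nonneg)
  obtain c where c: "\<And>w. (\<Sum>j\<le>d. c j * w ^ j) = (\<Sum>\<epsilon>\<in>cube n. noise n w f \<epsilon> * cnj (duality_map p (g \<epsilon>)))"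
    using noise_pairing_polynomial[OF deg, of "\<lambda>\<epsilon>. cnj (duality_map p (g \<epsilon>))"] by blast
  have pairing: "cmod (\<Sum>j\<le>d. c j * w ^ j) \<le> A powr (1 / p) * B powr ((p - 1) / p)"
    if "(\<Sum>\<epsilon>\<in>cube n. cmod (noise n w f \<epsilon>) powr p) \<le> A" for w
  proof -
    have "cmod (\<Sum>j\<le>d. c j * w ^ j) \<le> (\<Sum>\<epsilon>\<in>cube n. cmod (noise n w f \<epsilon>) * cmod (g \<epsilon>) powr (p - 1))"
      unfolding c by (rule order_trans[OF norm_sum]) (simp add: norm_mult norm_duality_map)
    also have "\<dots> \<le> (\<Sum>\<epsilon>\<in>cube n. cmod (noise n w f \<epsilon>) powr p) powr (1 / p) * B powr ((p - 1) / p)"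
      unfolding B_def by (rule sum_mult_powr_le) (use p in auto)
    also have "\<dots> \<le> A powr (1 / p) * B powr ((p - 1) / p)"
      using that p by (intro mult_right_mono powr_mono2) (auto intro: sum_nonneg)
    finally show ?thesis .
  qed
  have sector: "(\<Sum>\<epsilon>\<in>cube n. cmod (noise n (exp (- z)) f \<epsilon>) powr p) \<le> A"
    if "\<bar>Im z\<bar> * cos \<phi> \<le> Re z * sin \<phi>" for z
    unfolding A_def
  proof (rule sum_norm_noise_sector_le[OF p])
    have "\<bar>Im z\<bar> * (\<bar>p - 2\<bar> / p) \<le> Re z * (2 * sqrt (p - 1) / p)"
      using that theta_half[OF p] by (simp add: \<phi>_def)
    then show "\<bar>p - 2\<bar> * \<bar>Im z\<bar> \<le> 2 * sqrt (p - 1) * Re z"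
      using p by (simp add: divide_le_cancel mult_ac)
  qed
  have "cmod (\<Sum>j\<le>d. c j * (of_real (exp (real d powr - \<beta>))) ^ j) \<le> A powr (1 / p) * B powr ((p - 1) / p) * k"
    unfolding k_def
  proof (rule polynomial_bound_outside_spiral_corner)
    show "0 < \<phi>" "\<phi> \<le> pi / 2" using theta_half[OF p] by (simp_all only: \<phi>_def)
    show "\<beta> = 2 - 2 * \<phi> / pi" by (simp add: \<beta>_def \<phi>_def)
    fix z assume z: "\<bar>Im z\<bar> * cos \<phi> \<le> Re z * sin \<phi>"
    show "cmod (\<Sum>j\<le>d. c j * exp (- z) ^ j) \<le> A powr (1 / p) * B powr ((p - 1) / p)"
      by (rule pairing[OF sector[OF z]])
    show "cmod (\<Sum>j\<le>d. c j * (- exp (- z)) ^ j) \<le> A powr (1 / p) * B powr ((p - 1) / p)"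
      using sector[OF z] by (intro pairing) (simp only: sum_cube_noise_uminus[where g = "\<lambda>x. cmod x powr p"])
  qed (rule d)
  also have "(\<Sum>j\<le>d. c j * (of_real (exp (real d powr - \<beta>))) ^ j) = of_real B"
    unfolding c B_def of_real_sum by (simp add: mult_cnj_duality_map flip: g_def w0_def)
  finally have B: "B \<le> A powr (1 / p) * B powr ((p - 1) / p) * k" using AB by simp
  have "B \<le> k powr p * A"
  proof (cases "B = 0")
    case False
    then have B0: "0 < B" using AB by simp
    have "B = B powr (1 / p) * B powr ((p - 1) / p)"
      using B0 p by (simp flip: powr_add add_divide_distrib)
    with B have "B powr (1 / p) * B powr ((p - 1) / p) \<le> (k * A powr (1 / p)) * B powr ((p - 1) / p)"
      by (simp add: mult_ac)
    then have "B powr (1 / p) \<le> k * A powr (1 / p)" using B0 by simp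
    then have "(B powr (1 / p)) powr p \<le> (k * A powr (1 / p)) powr p"
      using p by (intro powr_mono2) auto
    then show ?thesis using B0 AB p by (simp add: powr_powr powr_mult k_def)
  qed (use AB in simp)
  then show "(\<Sum>\<epsilon>\<in>cube n. cmod (noise n (of_real (exp (real d powr - (2 - theta p / pi)))) f \<epsilon>) powr p) \<le>
      k powr p * (\<Sum>\<epsilon>\<in>cube n. cmod (f \<epsilon>) powr p)"
    by (simp add: A_def B_def g_def w0_def \<beta>_def)
qed

section \<open>Gradients of smoothed functions, large exponents\<close>

text \<open>
  Under the density \<open>noise_kernel n \<rho> \<epsilon>\<close> the products \<open>\<epsilon> i * \<delta> i\<close> are independent signs with mean \<open>\<rho>\<close>. The
  covariance of \<open>f\<close> with such a sign is a multiple of a partial derivative of the averaged function, because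
  \<open>(1 + \<rho> * x) * (x - \<rho>) = (1 - \<rho>\<^sup>2) * x\<close> for a sign \<open>x\<close>.
\<close>

lemma noise_centred_coordinate_mult:
  fixes f :: "(nat \<Rightarrow> real) \<Rightarrow> complex"
  assumes \<epsilon>: "\<epsilon> \<in> cube n" and i: "i \<in> {1..n}" and \<rho>: "\<rho> \<noteq> 0"
  shows "noise n (of_real \<rho>) (\<lambda>\<delta>. of_real (\<epsilon> i * \<delta> i - \<rho>) * f \<delta>) \<epsilon> =
    of_real ((1 - \<rho>\<^sup>2) / \<rho>) * cube_partial i (noise n (of_real \<rho>) f) \<epsilon>"
proof -
  let ?K = "noise_kernel n (complex_of_real \<rho>)"
  have K: "?K \<epsilon> \<delta> * of_real (\<epsilon> i * \<delta> i - \<rho>) =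
      of_real ((1 - \<rho>\<^sup>2) / \<rho>) * ((?K \<epsilon> \<delta> - ?K (\<epsilon>(i := - \<epsilon> i)) \<delta>) / 2)" if \<delta>: "\<delta> \<in> cube n" for \<delta>
  proof -
    define x where "x = \<epsilon> i * \<delta> i"
    define Q where "Q = (\<Prod>j\<in>{1..n} - {i}. 1 + complex_of_real \<rho> * of_real (\<epsilon> j * \<delta> j))"
    have "x = 1 \<or> x = -1"
      using cube_cases[OF \<epsilon> i] cube_cases[OF \<delta> i] by (auto simp: x_def)
    then have x: "(1 + \<rho> * x) * (x - \<rho>) = (1 - \<rho>\<^sup>2) * x"
      by (auto simp: power2_eq_square algebra_simps)
    have "?K \<epsilon> \<delta> = (1 + of_real \<rho> * of_real x) * Q"
      unfolding noise_kernel_def Q_def x_def using i by (intro prod.remove) auto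
    then have "?K \<epsilon> \<delta> * of_real (x - \<rho>) = of_real ((1 + \<rho> * x) * (x - \<rho>)) * Q" by simp
    also have "\<dots> = of_real ((1 - \<rho>\<^sup>2) / \<rho>) * (of_real \<rho> * of_real x * Q)"
      unfolding x using \<rho> by simp
    finally show ?thesis
      unfolding noise_kernel_flip_difference[OF i] by (simp add: x_def Q_def)
  qed
  have "noise n (of_real \<rho>) (\<lambda>\<delta>. of_real (\<epsilon> i * \<delta> i - \<rho>) * f \<delta>) \<epsilon> =
      (\<Sum>\<delta>\<in>cube n. (?K \<epsilon> \<delta> * of_real (\<epsilon> i * \<delta> i - \<rho>)) * f \<delta>) / 2 ^ n"
    by (simp add: noise_def mult.assoc)
  also have "\<dots> = (\<Sum>\<delta>\<in>cube n. of_real ((1 - \<rho>\<^sup>2) / \<rho>) *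
      ((?K \<epsilon> \<delta> * f \<delta> - ?K (\<epsilon>(i := - \<epsilon> i)) \<delta> * f \<delta>) / 2)) / 2 ^ n"
    by (intro arg_cong2[where f = "(/)"] sum.cong refl) (simp only: K, simp add: algebra_simps)
  also have "\<dots> = of_real ((1 - \<rho>\<^sup>2) / \<rho>) * cube_partial i (noise n (of_real \<rho>) f) \<epsilon>"
  proof -
    have "c * ((a - b) / 2) / e = c * ((a / e - b / e) / 2)" for a b c e :: complex
      by (simp add: diff_divide_distrib right_diff_distrib mult.commute)
    then show ?thesis
      by (simp only: sum_distrib_left[symmetric] sum_divide_distrib[symmetric] sum_subtractf
          cube_partial_def noise_def)
  qed
  finally show ?thesis .
qed

text \<open>
  Apply the covariance formula to the centred coordinate itself: its \<open>i\<close>-th partial derivative vanishes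
  unless \<open>i = j\<close>, when it is the uncentred coordinate, of mean \<open>\<rho>\<close>.
\<close>

lemma noise_centred_coordinates_orthogonal:
  assumes \<epsilon>: "\<epsilon> \<in> cube n" and i: "i \<in> {1..n}" and j: "j \<in> {1..n}" and \<rho>: "\<rho> \<noteq> 0"
  shows "noise n (complex_of_real \<rho>) (\<lambda>\<delta>. of_real (\<epsilon> i * \<delta> i - \<rho>) * of_real (\<epsilon> j * \<delta> j - \<rho>)) \<epsilon> =
    (if i = j then of_real (1 - \<rho>\<^sup>2) else 0)"
proof -
  let ?y = "\<lambda>j \<delta>. complex_of_real (\<epsilon> j * \<delta> j - \<rho>)"
  have mean: "noise n (complex_of_real \<rho>) (?y j) \<epsilon> = 0"
    using noise_centred_coordinate_mult[OF \<epsilon> j \<rho>, of "\<lambda>_. 1"] j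
    by (simp add: cube_partial_noise, simp add: cube_partial_def[abs_def] noise_def)
  have "noise n (complex_of_real \<rho>) (cube_partial i (?y j)) \<epsilon> = (if i = j then of_real \<rho> else 0)"
  proof (cases "i = j")
    case True
    have "cube_partial i (?y j) = (\<lambda>\<delta>. ?y j \<delta> + of_real \<rho>)"
      using True by (auto simp: cube_partial_def)
    then have "noise n (complex_of_real \<rho>) (cube_partial i (?y j)) \<epsilon> =
        noise n (complex_of_real \<rho>) (?y j) \<epsilon> + of_real \<rho>"
      by (simp only: noise_add noise_const[OF \<epsilon>])
    then show ?thesis using mean True by simp
  next
    case False
    then have "cube_partial i (?y j) = (\<lambda>_. 0)" by (auto simp: cube_partial_def)
    then show ?thesis using False by (simp add: noise_def)
  qed
  then show ?thesis
    unfolding noise_centred_coordinate_mult[OF \<epsilon> i \<rho>] cube_partial_noise[OF i] using \<rho> by simp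
qed

text \<open>
  Bessel's inequality for the orthogonal system of centred coordinates: \<open>L\<close> is the projection of \<open>f\<close> to their
  span, and the claim expands \<open>0 \<le> E \<bar>f - L\<bar>\<^sup>2\<close>.
\<close>

lemma grad_length_noise_le_variance:
  fixes f :: "(nat \<Rightarrow> real) \<Rightarrow> complex"
  assumes \<epsilon>: "\<epsilon> \<in> cube n" and \<rho>: "0 < \<rho>" "\<rho> \<le> 1"
  shows "(1 - \<rho>\<^sup>2) / \<rho>\<^sup>2 * (grad_length n (noise n (of_real \<rho>) f) \<epsilon>)\<^sup>2 \<le> noise n \<rho> (\<lambda>\<delta>. (cmod (f \<delta>))\<^sup>2) \<epsilon>"
proof -
  define E where "E = (\<lambda>g. noise n (complex_of_real \<rho>) g \<epsilon>)"
  define y where "y = (\<lambda>i \<delta>. complex_of_real (\<epsilon> i * \<delta> i - \<rho>))"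
  define D where "D = (\<lambda>i. cube_partial i (noise n (of_real \<rho>) f) \<epsilon>)"
  \<comment> \<open>\<open>c i * y i\<close> is the orthogonal projection of \<open>f\<close> to the span of \<open>y i\<close>.\<close>
  define c where "c = (\<lambda>i. D i / of_real \<rho>)"
  define s where "s = complex_of_real ((1 - \<rho>\<^sup>2) / \<rho>\<^sup>2)"
  have \<rho>0: "\<rho> \<noteq> 0" using \<rho> by simp
  have yf: "E (\<lambda>\<delta>. y i \<delta> * f \<delta>) = of_real ((1 - \<rho>\<^sup>2) / \<rho>) * D i" if "i \<in> {1..n}" for i
    using noise_centred_coordinate_mult[OF \<epsilon> that \<rho>0] by (simp add: E_def y_def D_def)
  have yy: "E (\<lambda>\<delta>. y i \<delta> * y j \<delta>) = (if i = j then of_real (1 - \<rho>\<^sup>2) else 0)"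
    if "i \<in> {1..n}" "j \<in> {1..n}" for i j
    using noise_centred_coordinates_orthogonal[OF \<epsilon> that \<rho>0] by (simp add: E_def y_def)
  have cnj: "E (\<lambda>\<delta>. cnj (g \<delta>)) = cnj (E g)" for g by (simp add: E_def noise_cnj)
  have lin: "E (\<lambda>\<delta>. g \<delta> + h \<delta>) = E g + E h" "E (\<lambda>\<delta>. g \<delta> - h \<delta>) = E g - E h"
    "E (\<lambda>\<delta>. a * g \<delta>) = a * E g" "E (\<lambda>\<delta>. \<Sum>i\<in>I. k i \<delta>) = (\<Sum>i\<in>I. E (k i))" for g h a k and I :: "nat set"
    by (simp_all add: E_def noise_add noise_diff noise_cmult noise_sum)
  define L where "L = (\<lambda>\<delta>. \<Sum>i=1..n. c i * y i \<delta>)"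
  have cnjL: "cnj (L \<delta>) = (\<Sum>i=1..n. cnj (c i) * y i \<delta>)" for \<delta>
    by (simp add: L_def y_def)
  have "E (\<lambda>\<delta>. cnj (L \<delta>) * f \<delta>) = E (\<lambda>\<delta>. \<Sum>i=1..n. cnj (c i) * (y i \<delta> * f \<delta>))"
    by (simp add: cnjL sum_distrib_right mult.assoc)
  also have "\<dots> = (\<Sum>i=1..n. cnj (c i) * (of_real ((1 - \<rho>\<^sup>2) / \<rho>) * D i))"
    by (simp add: lin yf)
  also have "\<dots> = (\<Sum>i=1..n. s * (D i * cnj (D i)))"
    using \<rho>0 by (intro sum.cong refl) (simp add: s_def c_def power2_eq_square)
  finally have Lf: "E (\<lambda>\<delta>. cnj (L \<delta>) * f \<delta>) = s * (\<Sum>i=1..n. D i * cnj (D i))"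
    by (simp add: sum_distrib_left)
  have "E (\<lambda>\<delta>. cnj (L \<delta>) * L \<delta>) = E (\<lambda>\<delta>. \<Sum>i=1..n. \<Sum>j=1..n. (cnj (c i) * c j) * (y i \<delta> * y j \<delta>))"
    unfolding cnjL unfolding L_def sum_product by (simp add: mult_ac)
  also have "\<dots> = (\<Sum>i=1..n. \<Sum>j=1..n. (cnj (c i) * c j) * (if i = j then of_real (1 - \<rho>\<^sup>2) else 0))"
    by (simp add: lin yy)
  also have "\<dots> = (\<Sum>i=1..n. \<Sum>j=1..n. if i = j then (cnj (c i) * c j) * of_real (1 - \<rho>\<^sup>2) else 0)"
    by (intro sum.cong refl) auto
  also have "\<dots> = (\<Sum>i=1..n. s * (D i * cnj (D i)))"
    using \<rho>0 by (simp only: sum.delta' finite_atLeastAtMost)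
      (intro sum.cong refl, simp add: s_def c_def power2_eq_square)
  finally have LL: "E (\<lambda>\<delta>. cnj (L \<delta>) * L \<delta>) = s * (\<Sum>i=1..n. D i * cnj (D i))"
    by (simp add: sum_distrib_left)
  have DD: "(\<Sum>i=1..n. D i * cnj (D i)) = of_real ((grad_length n (noise n (of_real \<rho>) f) \<epsilon>)\<^sup>2)"
    by (simp add: grad_length_def D_def sum_nonneg flip: complex_norm_square)
  have norm2: "(\<lambda>\<delta>. complex_of_real ((cmod (g \<delta>))\<^sup>2)) = (\<lambda>\<delta>. cnj (g \<delta>) * g \<delta>)" for g :: "(nat \<Rightarrow> real) \<Rightarrow> complex"
    by (simp only: complex_norm_square mult.commute)
  have "complex_of_real (noise n \<rho> (\<lambda>\<delta>. (cmod (f \<delta> - L \<delta>))\<^sup>2) \<epsilon>) = E (\<lambda>\<delta>. cnj (f \<delta> - L \<delta>) * (f \<delta> - L \<delta>))"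
    unfolding norm2[symmetric] E_def by (simp only: noise_of_real)
  also have "\<dots> = E (\<lambda>\<delta>. cnj (f \<delta>) * f \<delta> - cnj (cnj (L \<delta>) * f \<delta>) - cnj (L \<delta>) * f \<delta> + cnj (L \<delta>) * L \<delta>)"
    by (simp add: algebra_simps)
  also have "\<dots> = E (\<lambda>\<delta>. cnj (f \<delta>) * f \<delta>) - cnj (E (\<lambda>\<delta>. cnj (L \<delta>) * f \<delta>)) - E (\<lambda>\<delta>. cnj (L \<delta>) * f \<delta>) + E (\<lambda>\<delta>. cnj (L \<delta>) * L \<delta>)"
    by (simp only: lin cnj)
  also have "E (\<lambda>\<delta>. cnj (f \<delta>) * f \<delta>) = of_real (noise n \<rho> (\<lambda>\<delta>. (cmod (f \<delta>))\<^sup>2) \<epsilon>)"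
    unfolding norm2[symmetric] E_def by (simp only: noise_of_real)
  finally have "complex_of_real (noise n \<rho> (\<lambda>\<delta>. (cmod (f \<delta> - L \<delta>))\<^sup>2) \<epsilon>) =
      of_real (noise n \<rho> (\<lambda>\<delta>. (cmod (f \<delta>))\<^sup>2) \<epsilon> -
       (1 - \<rho>\<^sup>2) / \<rho>\<^sup>2 * (grad_length n (noise n (of_real \<rho>) f) \<epsilon>)\<^sup>2)"
    unfolding Lf LL DD s_def by simp
  then have "noise n \<rho> (\<lambda>\<delta>. (cmod (f \<delta> - L \<delta>))\<^sup>2) \<epsilon> = noise n \<rho> (\<lambda>\<delta>. (cmod (f \<delta>))\<^sup>2) \<epsilon> -
       (1 - \<rho>\<^sup>2) / \<rho>\<^sup>2 * (grad_length n (noise n (of_real \<rho>) f) \<epsilon>)\<^sup>2"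
    by (simp only: of_real_eq_iff)
  moreover have "0 \<le> noise n \<rho> (\<lambda>\<delta>. (cmod (f \<delta> - L \<delta>))\<^sup>2) \<epsilon>"
    using noise_mono[OF \<epsilon>, of \<rho> "\<lambda>_. 0" "\<lambda>\<delta>. (cmod (f \<delta> - L \<delta>))\<^sup>2"] \<rho> \<epsilon> by (simp add: noise_const)
  ultimately show ?thesis by simp
qed

text \<open>
  Since \<open>p / 2 \<ge> 1\<close>, Jensen's inequality raises the pointwise bound to the power \<open>p / 2\<close>.
\<close>

lemma sum_grad_length_noise_ge2:
  fixes f :: "(nat \<Rightarrow> real) \<Rightarrow> complex"
  assumes p: "2 \<le> p" and t: "0 < t"
  shows "(\<Sum>\<epsilon>\<in>cube n. grad_length n (noise n (of_real (exp (- t))) f) \<epsilon> powr p) \<le>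
    (2 * t) powr (- (p / 2)) * (\<Sum>\<epsilon>\<in>cube n. cmod (f \<epsilon>) powr p)"
proof -
  define \<rho> where "\<rho> = exp (- t)"
  have \<rho>: "0 < \<rho>" "\<rho> \<le> 1" "\<bar>\<rho>\<bar> \<le> 1" using t by (auto simp: \<rho>_def)
  have "grad_length n (noise n (of_real \<rho>) f) \<epsilon> powr p \<le>
      (2 * t) powr (- (p / 2)) * noise n \<rho> (\<lambda>\<delta>. cmod (f \<delta>) powr p) \<epsilon>" if \<epsilon>: "\<epsilon> \<in> cube n" for \<epsilon>
  proof -
    define G where "G = grad_length n (noise n (of_real \<rho>) f) \<epsilon>"
    define V where "V = noise n \<rho> (\<lambda>\<delta>. (cmod (f \<delta>))\<^sup>2) \<epsilon>"
    have "2 * t \<le> exp (2 * t) - 1" using exp_ge_add_one_self[of "2 * t"] by linarith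
    also have "\<dots> = (1 - \<rho>\<^sup>2) / \<rho>\<^sup>2"
      by (simp add: \<rho>_def exp_minus field_simps flip: exp_double)
    finally have "2 * t * G\<^sup>2 \<le> (1 - \<rho>\<^sup>2) / \<rho>\<^sup>2 * G\<^sup>2" by (intro mult_right_mono) auto
    also have "\<dots> \<le> V" unfolding G_def V_def by (rule grad_length_noise_le_variance[OF \<epsilon> \<rho>(1,2)])
    finally have GV: "(2 * t * G\<^sup>2) powr (p / 2) \<le> V powr (p / 2)"
      using p t by (intro powr_mono2) auto
    have "V powr (p / 2) \<le> noise n \<rho> (\<lambda>\<delta>. (cmod (f \<delta>))\<^sup>2 powr (p / 2)) \<epsilon>"
      unfolding V_def using p by (intro noise_powr_le[OF \<epsilon> \<rho>(3)]) auto
    also have "(\<lambda>\<delta>. (cmod (f \<delta>))\<^sup>2 powr (p / 2)) = (\<lambda>\<delta>. cmod (f \<delta>) powr p)"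
    proof
      fix \<delta> show "(cmod (f \<delta>))\<^sup>2 powr (p / 2) = cmod (f \<delta>) powr p"
        by (cases "f \<delta> = 0") (simp_all add: powr_powr flip: powr_numeral)
    qed
    finally have "(2 * t * G\<^sup>2) powr (p / 2) \<le> noise n \<rho> (\<lambda>\<delta>. cmod (f \<delta>) powr p) \<epsilon>" using GV by simp
    moreover have "(2 * t * G\<^sup>2) powr (p / 2) = (2 * t) powr (p / 2) * G powr p"
    proof -
      have G: "0 \<le> G" by (simp add: G_def)
      then have "(G\<^sup>2) powr (p / 2) = G powr p"
        by (cases "G = 0") (simp_all add: powr_powr flip: powr_numeral)
      then show ?thesis using t G by (simp add: powr_mult)
    qed
    ultimately show ?thesis
      using t by (simp add: powr_minus field_simps G_def)
  qed
  then have "(\<Sum>\<epsilon>\<in>cube n. grad_length n (noise n (of_real \<rho>) f) \<epsilon> powr p) \<le>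
      (\<Sum>\<epsilon>\<in>cube n. (2 * t) powr (- (p / 2)) * noise n \<rho> (\<lambda>\<delta>. cmod (f \<delta>) powr p) \<epsilon>)"
    by (rule sum_mono)
  then show ?thesis by (simp add: \<rho>_def sum_noise flip: sum_distrib_left)
qed

section \<open>Gradients of smoothed functions, small exponents\<close>

text \<open>
  By the mean value theorem the increment of \<open>x powr (p - 1)\<close> is at least its derivative at the larger end
  point, as \<open>p - 2 < 0\<close>.
\<close>

lemma square_diff_le_powr_form:
  fixes a b p :: real
  assumes p: "1 < p" "p < 2" and ab: "0 \<le> a" "0 \<le> b"
  shows "(p - 1) * (a - b)\<^sup>2 \<le> (a - b) * (a powr (p - 1) - b powr (p - 1)) * max a b powr (2 - p)"
  using ab
proof (induction a b rule: linorder_wlog)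
  case (sym a b)
  then show ?case by (simp add: max.commute power2_commute algebra_simps)
next
  case (le a b)
  show ?case
  proof (cases "a = b")
    case False
    then have lt: "a < b" using le by simp
    have "(p - 1) * (b - a) \<le> (b powr (p - 1) - a powr (p - 1)) * b powr (2 - p)"
    proof (cases "a = 0")
      case True
      have "b powr (p - 1) * b powr (2 - p) = b" using lt True by (simp flip: powr_add)
      then show ?thesis using True lt p by simp
    next
      case False
      then have a: "0 < a" using le by simp
      have "\<exists>x>a. x < b \<and> b powr (p - 1) - a powr (p - 1) = (b - a) * ((p - 1) * x powr (p - 2))"
        by (rule MVT2[OF lt]) (use a in \<open>auto intro!: derivative_eq_intros\<close>)
      then obtain x where x: "a < x" "x < b"
        "b powr (p - 1) - a powr (p - 1) = (b - a) * ((p - 1) * x powr (p - 2))" by blast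
      have "1 = b powr (p - 2) * b powr (2 - p)" using lt a by (simp flip: powr_add)
      also have "\<dots> \<le> x powr (p - 2) * b powr (2 - p)"
        using x a p by (intro mult_right_mono powr_mono2') auto
      finally have "(p - 1) * (b - a) * 1 \<le> (p - 1) * (b - a) * (x powr (p - 2) * b powr (2 - p))"
        using p lt by (intro mult_left_mono) auto
      then show ?thesis unfolding x(3) by (simp add: mult_ac)
    qed
    then have "(b - a) * ((p - 1) * (b - a)) \<le> (b - a) * ((b powr (p - 1) - a powr (p - 1)) * b powr (2 - p))"
      using lt by (intro mult_left_mono) auto
    then show ?thesis using lt by (simp add: max_def power2_eq_square algebra_simps)
  qed simp
qed

lemma powr_form_nonneg:
  fixes a b p :: real
  assumes "1 < p" "0 \<le> a" "0 \<le> b"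
  shows "0 \<le> (a - b) * (a powr (p - 1) - b powr (p - 1))"
  using powr_mono2[of "p - 1" a b] powr_mono2[of "p - 1" b a] assms
  by (cases "a \<le> b") (auto simp: zero_le_mult_iff)

text \<open>
  When \<open>b\<close> is at most comparable to \<open>a\<close>, the maximum can be replaced by the value \<open>a\<close> at the base point, which
  does not depend on the edge.
\<close>

lemma powr_form_comparable:
  fixes a b p :: real
  assumes p: "1 < p" "p < 2" and ab: "0 \<le> a" "0 \<le> b" "b \<le> 2 * a"
  shows "(a - b)\<^sup>2 \<le> 2 / (p - 1) * ((a - b) * (a powr (p - 1) - b powr (p - 1))) * a powr (2 - p)"
proof -
  define q where "q = (a - b) * (a powr (p - 1) - b powr (p - 1))"
  have q: "0 \<le> q"
    unfolding q_def using ab p by (intro powr_form_nonneg)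
  have "max a b powr (2 - p) \<le> (2 * a) powr (2 - p)" using ab p by (intro powr_mono2) auto
  also have "\<dots> = 2 powr (2 - p) * a powr (2 - p)" using ab by (simp add: powr_mult)
  also have "\<dots> \<le> 2 powr 1 * a powr (2 - p)"
    using p by (intro mult_right_mono powr_mono) auto
  finally have "q * max a b powr (2 - p) \<le> q * (2 * a powr (2 - p))"
    using q by (intro mult_left_mono) auto
  from order_trans[OF square_diff_le_powr_form[OF p ab(1,2), folded q_def] this]
  have "(p - 1) * (a - b)\<^sup>2 \<le> 2 * q * a powr (2 - p)" by (simp add: mult_ac)
  then show ?thesis using p by (simp add: q_def field_simps)
qed

text \<open>
  When \<open>b\<close> is much larger than \<open>a\<close>, it is comparable to the difference, so the form dominates the \<open>p\<close>-th
  power of the difference.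
\<close>

lemma powr_form_far:
  fixes a b p :: real
  assumes p: "1 < p" "p < 2" and ab: "0 \<le> a" "2 * a < b"
  shows "\<bar>a - b\<bar> powr p \<le> 2 / (p - 1) * ((a - b) * (a powr (p - 1) - b powr (p - 1)))"
proof -
  define q where "q = (a - b) * (a powr (p - 1) - b powr (p - 1))"
  define h where "h = b - a"
  have h: "0 < h" "b \<le> 2 * h" "0 \<le> b" "a \<le> b" using ab by (auto simp: h_def)
  have q: "0 \<le> q"
    unfolding q_def using ab h p by (intro powr_form_nonneg)
  have "b powr (2 - p) \<le> (2 * h) powr (2 - p)" using h p by (intro powr_mono2) auto
  also have "\<dots> = 2 powr (2 - p) * h powr (2 - p)" using h by (simp add: powr_mult)
  also have "\<dots> \<le> 2 powr 1 * h powr (2 - p)"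
    using p by (intro mult_right_mono powr_mono) auto
  finally have "q * b powr (2 - p) \<le> q * (2 * h powr (2 - p))"
    using q by (intro mult_left_mono) auto
  moreover have "(p - 1) * h\<^sup>2 \<le> q * b powr (2 - p)"
    using square_diff_le_powr_form[OF p ab(1) h(3), folded q_def] h(4)
    by (simp add: h_def max_absorb2 power2_commute)
  ultimately have "(p - 1) * h\<^sup>2 \<le> 2 * q * h powr (2 - p)" by simp
  moreover have "h\<^sup>2 = h powr p * h powr (2 - p)"
    using h by (simp flip: powr_add)
  ultimately have "(p - 1) * h powr p \<le> 2 * q" using h by (simp add: mult.assoc[symmetric])
  then show ?thesis using p h by (simp add: q_def h_def field_simps)
qed

text \<open>
  After division by the total, every term is at most one and so at most its power of exponent \<open>s\<close>.
\<close>

lemma powr_sum_le: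
  fixes x :: "'a \<Rightarrow> real"
  assumes "finite I" "\<And>i. i \<in> I \<Longrightarrow> 0 \<le> x i" and s: "0 < s" "s \<le> 1"
  shows "(\<Sum>i\<in>I. x i) powr s \<le> (\<Sum>i\<in>I. x i powr s)"
proof (cases "(\<Sum>i\<in>I. x i) = 0")
  case False
  define m where "m = (\<Sum>i\<in>I. x i)"
  have m: "0 < m" using False assms by (simp add: m_def order_less_le sum_nonneg)
  have "x i / m \<le> (x i / m) powr s" if "i \<in> I" for i
  proof (cases "x i = 0")
    case False
    have "x i \<le> m" unfolding m_def using assms that by (intro member_le_sum) auto
    then have "(x i / m) powr 1 \<le> (x i / m) powr s"
      using m s assms(2)[OF that] False by (intro powr_mono') auto
    then show ?thesis using m assms(2)[OF that] by simp
  qed simp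
  then have "(\<Sum>i\<in>I. x i / m) \<le> (\<Sum>i\<in>I. (x i / m) powr s)" by (rule sum_mono)
  also have "\<dots> = (\<Sum>i\<in>I. x i powr s) / m powr s"
    unfolding sum_divide_distrib using m assms by (intro sum.cong refl) (auto simp: powr_divide)
  finally have "1 \<le> (\<Sum>i\<in>I. x i powr s) / m powr s"
    using m by (simp add: m_def flip: sum_divide_distrib)
  then show ?thesis using m by (simp add: le_divide_eq m_def)
qed (simp add: sum_nonneg)

lemma powr_weighted_mean_le:
  fixes x y s :: real
  assumes "0 \<le> x" "0 \<le> y" "0 \<le> s" "s \<le> 1"
  shows "x powr (1 - s) * y powr s \<le> x + y"
proof (cases "x = 0 \<or> y = 0")
  case False
  then have "x powr (1 - s) * y powr s \<le> (1 - s) * x + s * y"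
    using assms by (intro Youngs_inequality_0) auto
  also have "\<dots> \<le> 1 * x + 1 * y" using assms by (intro add_mono mult_right_mono) auto
  finally show ?thesis by simp
qed (use assms in auto)

text \<open>
  Here \<open>a\<close> is the value of a function at a vertex, \<open>b i\<close> are the values at its neighbours, and \<open>Q\<close> is the
  dissipation at the vertex. Neighbours with \<open>b i \<le> 2 * a\<close> contribute to the square sum at most a multiple of
  \<open>a powr (2 - p) * Q\<close>, whose power \<open>p / 2\<close> is split by the weighted mean inequality with weight \<open>t\<close>. For the
  other neighbours the power \<open>p / 2\<close> is moved inside the sum, where each term is bounded by dissipation.
\<close>

lemma sum_square_diff_powr_le:
  fixes a t p :: real and b :: "'a \<Rightarrow> real"
  assumes p: "1 < p" "p < 2" and t: "0 < t" "t \<le> 1" and fin: "finite I"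
    and a: "0 \<le> a" and b: "\<And>i. i \<in> I \<Longrightarrow> 0 \<le> b i"
  defines "Q \<equiv> \<Sum>i\<in>I. (a - b i) * (a powr (p - 1) - b i powr (p - 1))"
  shows "(\<Sum>i\<in>I. (a - b i)\<^sup>2) powr (p / 2) \<le> 2 / (p - 1) / t * (a powr p + 2 * (t * Q))"
proof -
  define \<kappa> where "\<kappa> = 2 / (p - 1)"
  define q where "q = (\<lambda>i. (a - b i) * (a powr (p - 1) - b i powr (p - 1)))"
  define I1 I2 where "I1 = {i \<in> I. b i \<le> 2 * a}" and "I2 = {i \<in> I. 2 * a < b i}"
  define G1 G2 where "G1 = (\<Sum>i\<in>I1. (a - b i)\<^sup>2)" and "G2 = (\<Sum>i\<in>I2. (a - b i)\<^sup>2)"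
  have I: "I = I1 \<union> I2" "I1 \<inter> I2 = {}" "finite I1" "finite I2"
    using fin by (auto simp: I1_def I2_def)
  have \<kappa>: "1 \<le> \<kappa>" using p by (simp add: \<kappa>_def)
  have q: "0 \<le> q i" if "i \<in> I" for i
    unfolding q_def using a b[OF that] p by (intro powr_form_nonneg)
  have Q: "Q = sum q I" "0 \<le> Q" using q by (auto simp: Q_def q_def intro: sum_nonneg)
  have qI1: "sum q I1 \<le> Q" and qI2: "sum q I2 \<le> Q"
    unfolding Q using fin q by (auto intro!: sum_mono2 simp: I1_def I2_def)
  have "G1 \<le> (\<Sum>i\<in>I1. \<kappa> * q i * a powr (2 - p))"
    unfolding G1_def \<kappa>_def q_def using p a b by (intro sum_mono powr_form_comparable) (auto simp: I1_def)
  also have "\<dots> = \<kappa> * sum q I1 * a powr (2 - p)" by (simp add: sum_distrib_left sum_distrib_right)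
  also have "\<dots> \<le> \<kappa> * Q * a powr (2 - p)"
    using \<kappa> qI1 by (intro mult_left_mono mult_right_mono) auto
  finally have G1: "G1 \<le> \<kappa> * (a powr (2 - p) * Q)" by (simp add: mult_ac)
  have "G1 powr (p / 2) \<le> (\<kappa> * (a powr (2 - p) * Q)) powr (p / 2)"
    using G1 p by (intro powr_mono2) (auto simp: G1_def sum_nonneg)
  also have "\<dots> = (\<kappa> / t) powr (p / 2) * ((a powr p) powr (1 - p / 2) * (t * Q) powr (p / 2))"
  proof -
    have "\<kappa> * (a powr (2 - p) * Q) = \<kappa> / t * (a powr (2 - p) * (t * Q))" using t by simp
    moreover have "(a powr (2 - p)) powr (p / 2) = (a powr p) powr (1 - p / 2)"
    proof -
      have "(2 - p) * (p / 2) = p * (1 - p / 2)" by (simp add: field_simps)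
      then show ?thesis by (simp only: powr_powr)
    qed
    ultimately show ?thesis using \<kappa> t Q a by (simp only: powr_mult mult_nonneg_nonneg powr_ge_zero)
  qed
  also have "\<dots> \<le> (\<kappa> / t) powr 1 * (a powr p + t * Q)"
    using \<kappa> t Q p by (intro mult_mono powr_weighted_mean_le powr_mono) (auto simp: le_divide_eq)
  finally have 1: "G1 powr (p / 2) \<le> \<kappa> / t * (a powr p + t * Q)"
    using \<kappa> t by simp
  have "G2 powr (p / 2) \<le> (\<Sum>i\<in>I2. ((a - b i)\<^sup>2) powr (p / 2))"
    unfolding G2_def using p I by (intro powr_sum_le) auto
  also have "\<dots> \<le> (\<Sum>i\<in>I2. \<kappa> * q i)"
  proof (rule sum_mono)
    fix i assume i: "i \<in> I2"
    then have "((a - b i)\<^sup>2) powr (p / 2) = \<bar>a - b i\<bar> powr p"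
    proof -
      have "(a - b i)\<^sup>2 = \<bar>a - b i\<bar> powr 2" by (simp only: powr_numeral abs_ge_zero power2_abs)
      then show ?thesis by (simp only: powr_powr) simp
    qed
    also have "\<dots> \<le> \<kappa> * q i"
      unfolding \<kappa>_def q_def using i by (intro powr_form_far p a) (auto simp: I2_def)
    finally show "((a - b i)\<^sup>2) powr (p / 2) \<le> \<kappa> * q i" .
  qed
  also have "\<dots> \<le> \<kappa> * Q" using \<kappa> qI2 by (simp flip: sum_distrib_left)
  also have "\<dots> = \<kappa> / t * (t * Q)" using t by simp
  finally have 2: "G2 powr (p / 2) \<le> \<kappa> / t * (t * Q)" .
  have "(\<Sum>i\<in>I. (a - b i)\<^sup>2) = G1 + G2"
    unfolding G1_def G2_def by (subst I(1), rule sum.union_disjoint) (use I in auto)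
  also have "\<dots> powr (p / 2) \<le> G1 powr (p / 2) + G2 powr (p / 2)"
    using powr_sum_le[of "{True, False}" "\<lambda>j. if j then G1 else G2" "p / 2"] p
    by (auto simp: G1_def G2_def sum_nonneg)
  also have "\<dots> \<le> \<kappa> / t * (a powr p + t * Q) + \<kappa> / t * (t * Q)" using 1 2 by (rule add_mono)
  also have "\<dots> = \<kappa> / t * (a powr p + 2 * (t * Q))"
    by (simp only: mult_2 distrib_left add.assoc)
  finally show ?thesis by (simp only: \<kappa>_def)
qed

lemma grad_length_sq_le:
  fixes u :: "(nat \<Rightarrow> real) \<Rightarrow> real"
  shows "(grad_length n (\<lambda>\<delta>. of_real (u \<delta>)) \<epsilon>)\<^sup>2 \<le> (\<Sum>i=1..n. (u \<epsilon> - u (\<epsilon>(i := - \<epsilon> i)))\<^sup>2)"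
proof -
  have "(grad_length n (\<lambda>\<delta>. of_real (u \<delta>)) \<epsilon>)\<^sup>2 = (\<Sum>i=1..n. ((u \<epsilon> - u (\<epsilon>(i := - \<epsilon> i))) / 2)\<^sup>2)"
  proof -
    have "cmod (cube_partial i (\<lambda>\<delta>. of_real (u \<delta>)) \<epsilon>) = \<bar>(u \<epsilon> - u (\<epsilon>(i := - \<epsilon> i))) / 2\<bar>" for i
      unfolding cube_partial_def norm_of_real[symmetric, where 'a = complex] by simp
    then show ?thesis
      by (simp only: grad_length_def power2_abs real_sqrt_pow2 sum_nonneg zero_le_power2)
  qed
  also have "\<dots> \<le> (\<Sum>i=1..n. (u \<epsilon> - u (\<epsilon>(i := - \<epsilon> i)))\<^sup>2)"
    by (intro sum_mono) (simp add: power_divide)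
  finally show ?thesis .
qed

text \<open>
  The total dissipation of \<open>h\<close> over the time interval from \<open>0\<close> to \<open>t\<close> is at most \<open>h 0 = A\<close>. The mean value theorem
  gives a time \<open>s\<close> at which \<open>t\<close> times the dissipation is at most a multiple of \<open>A\<close>; there the pointwise estimate
  bounds the gradient, and the gradient at time \<open>t\<close> is an average of the gradient at time \<open>s\<close>.
\<close>

lemma sum_grad_length_noise_nonneg:
  fixes \<phi> :: "(nat \<Rightarrow> real) \<Rightarrow> real"
  assumes p: "1 < p" "p < 2" and t: "0 < t" "t \<le> 1" and \<phi>: "\<And>\<epsilon>. 0 \<le> \<phi> \<epsilon>"
  shows "(\<Sum>\<epsilon>\<in>cube n. grad_length n (noise n (of_real (exp (- t))) (\<lambda>\<delta>. of_real (\<phi> \<delta>))) \<epsilon> powr p) \<le>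
    18 / (p - 1) / t * (\<Sum>\<epsilon>\<in>cube n. \<phi> \<epsilon> powr p)"
proof -
  define u where "u = (\<lambda>r. noise n (exp (- r)) \<phi>)"
  define F where "F = (\<lambda>\<delta>. complex_of_real (\<phi> \<delta>))"
  define A where "A = (\<Sum>\<epsilon>\<in>cube n. \<phi> \<epsilon> powr p)"
  define Q where "Q = (\<lambda>r \<epsilon>. \<Sum>i=1..n. (u r \<epsilon> - u r (\<epsilon>(i := - \<epsilon> i))) *
    (u r \<epsilon> powr (p - 1) - u r (\<epsilon>(i := - \<epsilon> i)) powr (p - 1)))"
  have U: "noise n (of_real (exp (- r))) F = (\<lambda>\<delta>. of_real (u r \<delta>))" for r
    unfolding F_def u_def by (intro ext) (simp only: noise_of_real)
  have u0: "0 \<le> u r \<epsilon>" if "\<epsilon> \<in> cube n" "0 \<le> r" for r \<epsilon>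
    using noise_mono[OF that(1), of "exp (- r)" "\<lambda>_. 0" \<phi>] \<phi> that by (simp add: u_def noise_const)
  have uA: "(\<Sum>\<epsilon>\<in>cube n. u r \<epsilon> powr p) \<le> A" if "0 \<le> r" for r
  proof -
    have "(\<Sum>\<epsilon>\<in>cube n. u r \<epsilon> powr p) \<le> (\<Sum>\<epsilon>\<in>cube n. noise n (exp (- r)) (\<lambda>\<delta>. \<phi> \<delta> powr p) \<epsilon>)"
      unfolding u_def using \<phi> p that by (intro sum_mono noise_powr_le) auto
    then show ?thesis by (simp add: sum_noise A_def)
  qed
  define h where "h = (\<lambda>r. \<Sum>\<epsilon>\<in>cube n. u r \<epsilon> powr p)"
  \<comment> \<open>This agrees with \<open>h\<close> for \<open>r \<ge> 0\<close>, and the general formula for the dissipation gives its derivative.\<close>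
  define H where "H = (\<lambda>r::real. \<Sum>\<epsilon>\<in>cube n. cmod (noise n (exp (- (of_real r * 1))) F \<epsilon>) powr p)"
  have exp: "exp (- (of_real r * 1)) = complex_of_real (exp (- r))" for r
    by (simp add: exp_of_real flip: of_real_minus)
  have Hh: "H r = h r" if "0 \<le> r" for r
    unfolding H_def h_def exp U using u0[OF _ that] by (intro sum.cong refl) simp
  have deriv: "(H has_real_derivative - (p / 4) * (\<Sum>\<epsilon>\<in>cube n. Q r \<epsilon>)) (at r)" if r: "0 \<le> r" for r
  proof -
    have "Re (1 * two_point_form p (of_real (u r \<epsilon>)) (of_real (u r (\<epsilon>(i := - \<epsilon> i))))) =
        (u r \<epsilon> - u r (\<epsilon>(i := - \<epsilon> i))) * (u r \<epsilon> powr (p - 1) - u r (\<epsilon>(i := - \<epsilon> i)) powr (p - 1))"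
      if "\<epsilon> \<in> cube n" "i \<in> {1..n}" for \<epsilon> i
      using u0[OF that(1) r] u0[OF flip_in_cube[OF that] r] by (simp add: two_point_form_def duality_map_of_real)
    then have "(\<Sum>\<epsilon>\<in>cube n. \<Sum>i=1..n. Re (1 * two_point_form p (noise n (exp (- (of_real r * 1))) F \<epsilon>)
        (noise n (exp (- (of_real r * 1))) F (\<epsilon>(i := - \<epsilon> i))))) = (\<Sum>\<epsilon>\<in>cube n. Q r \<epsilon>)"
      unfolding exp U Q_def by (intro sum.cong refl) blast
    moreover have "(H has_real_derivative - (p / 4) * (\<Sum>\<epsilon>\<in>cube n. \<Sum>i=1..n.
        Re (1 * two_point_form p (noise n (exp (- (of_real r * 1))) F \<epsilon>)
          (noise n (exp (- (of_real r * 1))) F (\<epsilon>(i := - \<epsilon> i)))))) (at r)"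
      unfolding H_def by (rule sum_norm_noise_has_real_derivative[OF p(1)])
    ultimately show ?thesis by (simp only:)
  qed
  obtain s where s: "0 < s" "s < t" "H t - H 0 = (t - 0) * (- (p / 4) * (\<Sum>\<epsilon>\<in>cube n. Q s \<epsilon>))"
    using MVT2[OF t(1), of H "\<lambda>r. - (p / 4) * (\<Sum>\<epsilon>\<in>cube n. Q r \<epsilon>)"] deriv by auto
  have "H 0 \<le> A" "0 \<le> H t" using Hh[of 0] uA[of 0] by (auto simp: h_def H_def intro: sum_nonneg)
  then have "p / 4 * (t * (\<Sum>\<epsilon>\<in>cube n. Q s \<epsilon>)) \<le> A" using s(3) by (simp add: mult_ac)
  moreover have Q0: "0 \<le> Q s \<epsilon>" if "\<epsilon> \<in> cube n" for \<epsilon>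
    unfolding Q_def
  proof (rule sum_nonneg)
    fix i assume i: "i \<in> {1..n}"
    show "0 \<le> (u s \<epsilon> - u s (\<epsilon>(i := - \<epsilon> i))) * (u s \<epsilon> powr (p - 1) - u s (\<epsilon>(i := - \<epsilon> i)) powr (p - 1))"
      using u0[OF that, of s] u0[OF flip_in_cube[OF that i], of s] s p by (intro powr_form_nonneg) auto
  qed
  ultimately have tQ: "t * (\<Sum>\<epsilon>\<in>cube n. Q s \<epsilon>) \<le> 4 * A"
  proof -
    assume *: "p / 4 * (t * (\<Sum>\<epsilon>\<in>cube n. Q s \<epsilon>)) \<le> A"
    have "1 * (t * (\<Sum>\<epsilon>\<in>cube n. Q s \<epsilon>)) \<le> p * (t * (\<Sum>\<epsilon>\<in>cube n. Q s \<epsilon>))"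
      using p t Q0 by (intro mult_right_mono mult_nonneg_nonneg sum_nonneg) auto
    then show ?thesis using * by simp
  qed
  have "(\<Sum>\<epsilon>\<in>cube n. grad_length n (noise n (of_real (exp (- t))) F) \<epsilon> powr p) =
      (\<Sum>\<epsilon>\<in>cube n. grad_length n (noise n (of_real (exp (- (t - s)))) (noise n (of_real (exp (- s))) F)) \<epsilon> powr p)"
    by (intro sum.cong refl arg_cong2[where f = "(powr)"] grad_length_cong)
      (simp_all add: noise_noise flip: of_real_mult exp_add)
  also have "\<dots> \<le> (\<Sum>\<epsilon>\<in>cube n. grad_length n (noise n (of_real (exp (- s))) F) \<epsilon> powr p)"
    using s p by (intro sum_grad_length_noise_le) auto
  also have "\<dots> \<le> (\<Sum>\<epsilon>\<in>cube n. 2 / (p - 1) / t * (u s \<epsilon> powr p + 2 * (t * Q s \<epsilon>)))"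
  proof (rule sum_mono)
    fix \<epsilon> assume \<epsilon>: "\<epsilon> \<in> cube n"
    define G where "G = grad_length n (noise n (of_real (exp (- s))) F) \<epsilon>"
    have "G powr p = (G\<^sup>2) powr (p / 2)"
      by (cases "G = 0") (simp_all add: G_def powr_powr flip: powr_numeral)
    also have "\<dots> \<le> (\<Sum>i=1..n. (u s \<epsilon> - u s (\<epsilon>(i := - \<epsilon> i)))\<^sup>2) powr (p / 2)"
      unfolding G_def U using p by (intro powr_mono2 grad_length_sq_le) auto
    also have "\<dots> \<le> 2 / (p - 1) / t * (u s \<epsilon> powr p + 2 * (t * Q s \<epsilon>))"
      unfolding Q_def using u0[OF \<epsilon>] u0[OF flip_in_cube[OF \<epsilon>]] s
      by (intro sum_square_diff_powr_le p t) auto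
    finally show "G powr p \<le> 2 / (p - 1) / t * (u s \<epsilon> powr p + 2 * (t * Q s \<epsilon>))" .
  qed
  also have "\<dots> = 2 / (p - 1) / t * (h s + 2 * (t * (\<Sum>\<epsilon>\<in>cube n. Q s \<epsilon>)))"
    unfolding h_def by (simp only: sum.distrib sum_distrib_left[symmetric])
  also have "\<dots> \<le> 2 / (p - 1) / t * (A + 2 * (4 * A))"
    using uA[of s] s p t tQ by (intro mult_left_mono add_mono) (auto simp: h_def)
  also have "\<dots> = 18 / (p - 1) / t * A" by simp
  finally show ?thesis by (simp add: F_def A_def)
qed

lemma grad_length_add_cmult:
  assumes "cmod c = 1"
  shows "grad_length n (\<lambda>\<delta>. f \<delta> + c * g \<delta>) \<epsilon> \<le> grad_length n f \<epsilon> + grad_length n g \<epsilon>"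
proof -
  have "grad_length n (\<lambda>\<delta>. f \<delta> + c * g \<delta>) \<epsilon> \<le>
      L2_set (\<lambda>i. cmod (cube_partial i f \<epsilon>) + cmod (cube_partial i g \<epsilon>)) {1..n}"
    unfolding grad_length_L2_set
  proof (rule L2_set_mono)
    fix i
    have "cube_partial i (\<lambda>\<delta>. f \<delta> + c * g \<delta>) \<epsilon> = cube_partial i f \<epsilon> + c * cube_partial i g \<epsilon>"
      by (simp add: cube_partial_def algebra_simps add_divide_distrib diff_divide_distrib)
    then show "cmod (cube_partial i (\<lambda>\<delta>. f \<delta> + c * g \<delta>) \<epsilon>) \<le> cmod (cube_partial i f \<epsilon>) + cmod (cube_partial i g \<epsilon>)"
      using assms norm_triangle_ineq[of "cube_partial i f \<epsilon>" "c * cube_partial i g \<epsilon>"] by (simp add: norm_mult)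
  qed simp
  also have "\<dots> \<le> grad_length n f \<epsilon> + grad_length n g \<epsilon>"
    unfolding grad_length_L2_set by (rule L2_set_triangle_ineq)
  finally show ?thesis .
qed

lemma sum_grad_length_noise_add:
  assumes p: "1 < p" "p < 2" and c: "cmod c = 1"
    and f: "(\<Sum>\<epsilon>\<in>cube n. grad_length n (noise n w f) \<epsilon> powr p) \<le> X"
    and g: "(\<Sum>\<epsilon>\<in>cube n. grad_length n (noise n w g) \<epsilon> powr p) \<le> Y"
  shows "(\<Sum>\<epsilon>\<in>cube n. grad_length n (noise n w (\<lambda>\<delta>. f \<delta> + c * g \<delta>)) \<epsilon> powr p) \<le> 4 * (X + Y)"
proof -
  have two: "(x + y) powr p \<le> 4 * (x powr p + y powr p)" if "0 \<le> x" "0 \<le> y" for x y :: real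
  proof -
    have "(x + y) powr p \<le> (2 * max x y) powr p" using that p by (intro powr_mono2) auto
    also have "\<dots> = 2 powr p * max x y powr p" using that by (simp add: powr_mult)
    also have "\<dots> \<le> 2 powr 2 * (x powr p + y powr p)"
      using p by (intro mult_mono powr_mono) (auto simp: max_def)
    finally show ?thesis by simp
  qed
  have "(\<Sum>\<epsilon>\<in>cube n. grad_length n (noise n w (\<lambda>\<delta>. f \<delta> + c * g \<delta>)) \<epsilon> powr p) \<le>
      (\<Sum>\<epsilon>\<in>cube n. 4 * (grad_length n (noise n w f) \<epsilon> powr p + grad_length n (noise n w g) \<epsilon> powr p))"
  proof (rule sum_mono)
    fix \<epsilon>
    have "noise n w (\<lambda>\<delta>. f \<delta> + c * g \<delta>) = (\<lambda>\<delta>. noise n w f \<delta> + c * noise n w g \<delta>)"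
      by (simp add: noise_add noise_cmult fun_eq_iff)
    then have "grad_length n (noise n w (\<lambda>\<delta>. f \<delta> + c * g \<delta>)) \<epsilon> powr p \<le>
        (grad_length n (noise n w f) \<epsilon> + grad_length n (noise n w g) \<epsilon>) powr p"
      using p grad_length_add_cmult[OF c] by (intro powr_mono2) auto
    also have "\<dots> \<le> 4 * (grad_length n (noise n w f) \<epsilon> powr p + grad_length n (noise n w g) \<epsilon> powr p)"
      by (rule two) auto
    finally show "grad_length n (noise n w (\<lambda>\<delta>. f \<delta> + c * g \<delta>)) \<epsilon> powr p \<le> \<dots>" .
  qed
  also have "\<dots> \<le> 4 * (X + Y)" using f g by (simp add: sum.distrib flip: sum_distrib_left)
  finally show ?thesis .
qed

text \<open>
  The function is split into the positive and negative parts of its real and imaginary parts, each of which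
  is bounded by \<open>cmod (f \<delta>)\<close>.
\<close>

lemma sum_grad_length_noise_lt2:
  fixes f :: "(nat \<Rightarrow> real) \<Rightarrow> complex"
  assumes p: "1 < p" "p < 2" and t: "0 < t" "t \<le> 1"
  shows "(\<Sum>\<epsilon>\<in>cube n. grad_length n (noise n (of_real (exp (- t))) f) \<epsilon> powr p) \<le>
    1152 / (p - 1) / t * (\<Sum>\<epsilon>\<in>cube n. cmod (f \<epsilon>) powr p)"
proof -
  define B where "B = 18 / (p - 1) / t * (\<Sum>\<epsilon>\<in>cube n. cmod (f \<epsilon>) powr p)"
  have part: "(\<Sum>\<epsilon>\<in>cube n. grad_length n (noise n (of_real (exp (- t))) (\<lambda>\<delta>. of_real (\<phi> \<delta>))) \<epsilon> powr p) \<le> B"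
    if "\<And>\<delta>. 0 \<le> \<phi> \<delta>" "\<And>\<delta>. \<phi> \<delta> \<le> cmod (f \<delta>)" for \<phi>
  proof -
    have "(\<Sum>\<epsilon>\<in>cube n. grad_length n (noise n (of_real (exp (- t))) (\<lambda>\<delta>. of_real (\<phi> \<delta>))) \<epsilon> powr p) \<le>
        18 / (p - 1) / t * (\<Sum>\<epsilon>\<in>cube n. \<phi> \<epsilon> powr p)"
      by (rule sum_grad_length_noise_nonneg[OF p t that(1)])
    also have "\<dots> \<le> B"
      unfolding B_def using p t that by (intro mult_left_mono sum_mono powr_mono2) auto
    finally show ?thesis .
  qed
  have split: "(\<Sum>\<epsilon>\<in>cube n. grad_length n (noise n (of_real (exp (- t))) (\<lambda>\<delta>. of_real (h \<delta>))) \<epsilon> powr p) \<le> 4 * (B + B)"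
    if "\<And>\<delta>. \<bar>h \<delta>\<bar> \<le> cmod (f \<delta>)" for h
  proof -
    have "(\<lambda>\<delta>. complex_of_real (h \<delta>)) = (\<lambda>\<delta>. of_real (max (h \<delta>) 0) + (-1) * of_real (max (- h \<delta>) 0))"
      by (auto simp: max_def)
    then show ?thesis
      using that by (simp only:) (intro sum_grad_length_noise_add p part, auto simp: abs_le_iff)
  qed
  have "(\<lambda>\<delta>. of_real (Re (f \<delta>)) + \<i> * of_real (Im (f \<delta>))) = f"
    by (intro ext) (simp add: complex_eq_iff)
  moreover have "(\<Sum>\<epsilon>\<in>cube n. grad_length n (noise n (of_real (exp (- t)))
      (\<lambda>\<delta>. of_real (Re (f \<delta>)) + \<i> * of_real (Im (f \<delta>)))) \<epsilon> powr p) \<le> 4 * (4 * (B + B) + 4 * (B + B))"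
    by (intro sum_grad_length_noise_add p split abs_Re_le_cmod abs_Im_le_cmod) simp
  ultimately have "(\<Sum>\<epsilon>\<in>cube n. grad_length n (noise n (of_real (exp (- t))) f) \<epsilon> powr p) \<le>
      4 * (4 * (B + B) + 4 * (B + B))" by (simp only:)
  then show ?thesis by (simp add: B_def mult_ac)
qed

section \<open>The gradient inequality\<close>

lemma sum_grad_length_noise_powr_le:
  assumes p: "1 < p"
  obtains C where "0 < C" "\<And>n t f. 0 < t \<Longrightarrow> t \<le> 1 \<Longrightarrow>
    (\<Sum>\<epsilon>\<in>cube n. grad_length n (noise n (of_real (exp (- t))) f) \<epsilon> powr p) \<le>
      C * t powr (- max 1 (p / 2)) * (\<Sum>\<epsilon>\<in>cube n. cmod (f \<epsilon>) powr p)"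
proof (cases "p < 2")
  case True
  show ?thesis
  proof (rule that)
    show "0 < 1152 / (p - 1)" using p by simp
    fix n :: nat and t :: real and f :: "(nat \<Rightarrow> real) \<Rightarrow> complex"
    assume t: "0 < t" "t \<le> 1"
    show "(\<Sum>\<epsilon>\<in>cube n. grad_length n (noise n (of_real (exp (- t))) f) \<epsilon> powr p) \<le>
      1152 / (p - 1) * t powr (- max 1 (p / 2)) * (\<Sum>\<epsilon>\<in>cube n. cmod (f \<epsilon>) powr p)"
      using sum_grad_length_noise_lt2[OF p True t, of n f] True t by (simp add: powr_minus_divide max_def)
  qed
next
  case False
  show ?thesis
  proof (rule that)
    show "(0::real) < 1" by simp
    fix n :: nat and t :: real and f :: "(nat \<Rightarrow> real) \<Rightarrow> complex"
    assume t: "0 < t" "t \<le> 1"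
    have "(2 * t) powr (- (p / 2)) \<le> t powr (- (p / 2))" using t p by (intro powr_mono2') auto
    then have "(2 * t) powr (- (p / 2)) * (\<Sum>\<epsilon>\<in>cube n. cmod (f \<epsilon>) powr p) \<le>
        t powr (- (p / 2)) * (\<Sum>\<epsilon>\<in>cube n. cmod (f \<epsilon>) powr p)"
      by (intro mult_right_mono sum_nonneg) auto
    then show "(\<Sum>\<epsilon>\<in>cube n. grad_length n (noise n (of_real (exp (- t))) f) \<epsilon> powr p) \<le>
      1 * t powr (- max 1 (p / 2)) * (\<Sum>\<epsilon>\<in>cube n. cmod (f \<epsilon>) powr p)"
      using sum_grad_length_noise_ge2[of p t n f] False t by (simp add: max_def)
  qed
qed

text \<open>
  Apply the smoothing estimate to \<open>g = noise n (exp t) f\<close>, whose smoothing at time \<open>t\<close> is \<open>f\<close>.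
\<close>

lemma grad_Lp_norm_le:
  assumes p: "1 < p"
  obtains C where "0 < C" "\<And>n d f. 1 \<le> d \<Longrightarrow> degree_at_most n d f \<Longrightarrow>
    grad_Lp_norm p n f \<le> C * real d powr ((2 - theta p / pi) * max (1 / p) (1 / 2)) * cube_Lp_norm p n f"
proof -
  define \<beta> where "\<beta> = 2 - theta p / pi"
  have "theta p \<le> 2 * pi" using theta_half(2)[OF p] pi_gt_zero by linarith
  then have \<beta>: "0 \<le> \<beta>" by (simp add: \<beta>_def divide_le_eq)
  obtain K where K: "0 < K" "\<And>n d f. 1 \<le> d \<Longrightarrow> degree_at_most n d f \<Longrightarrow>
    (\<Sum>\<epsilon>\<in>cube n. cmod (noise n (of_real (exp (real d powr - \<beta>))) f \<epsilon>) powr p) \<le>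
      K * (\<Sum>\<epsilon>\<in>cube n. cmod (f \<epsilon>) powr p)"
    using sum_noise_inverse_le[OF p] unfolding \<beta>_def by blast
  obtain C where C: "0 < C" "\<And>n t f. 0 < t \<Longrightarrow> t \<le> 1 \<Longrightarrow>
    (\<Sum>\<epsilon>\<in>cube n. grad_length n (noise n (of_real (exp (- t))) f) \<epsilon> powr p) \<le>
      C * t powr (- max 1 (p / 2)) * (\<Sum>\<epsilon>\<in>cube n. cmod (f \<epsilon>) powr p)"
    using sum_grad_length_noise_powr_le[OF p] by blast
  show ?thesis
  proof (rule that)
    show "0 < (C * K) powr (1 / p)" using C K by simp
    fix n d :: nat and f :: "(nat \<Rightarrow> real) \<Rightarrow> complex"
    assume d: "1 \<le> d" and deg: "degree_at_most n d f"
    define t where "t = real d powr - \<beta>"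
    define g where "g = noise n (of_real (exp t)) f"
    define S where "S = (\<Sum>\<epsilon>\<in>cube n. cmod (f \<epsilon>) powr p)"
    define m where "m = max 1 (p / 2)"
    have S: "0 \<le> S" by (simp add: S_def sum_nonneg)
    have t: "0 < t" "t \<le> 1" using d \<beta> powr_mono[of "- \<beta>" 0 "real d"] by (auto simp: t_def)
    have "(\<Sum>\<epsilon>\<in>cube n. grad_length n f \<epsilon> powr p) =
        (\<Sum>\<epsilon>\<in>cube n. grad_length n (noise n (of_real (exp (- t))) g) \<epsilon> powr p)"
      by (intro sum.cong refl arg_cong2[where f = "(powr)"] grad_length_cong)
        (simp_all add: g_def noise_noise noise_one flip: of_real_mult exp_add)
    also have "\<dots> \<le> C * t powr (- m) * (\<Sum>\<epsilon>\<in>cube n. cmod (g \<epsilon>) powr p)"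
      unfolding m_def by (rule C(2)[OF t])
    also have "\<dots> \<le> C * t powr (- m) * (K * S)"
      using K(2)[OF d deg] C(1) by (intro mult_left_mono) (auto simp: g_def t_def S_def)
    finally have "(\<Sum>\<epsilon>\<in>cube n. grad_length n f \<epsilon> powr p) / 2 ^ n \<le> (C * K) * real d powr (\<beta> * m) * (S / 2 ^ n)"
      by (simp add: t_def powr_powr divide_right_mono mult_ac)
    then have "((\<Sum>\<epsilon>\<in>cube n. grad_length n f \<epsilon> powr p) / 2 ^ n) powr (1 / p) \<le>
        ((C * K) * real d powr (\<beta> * m) * (S / 2 ^ n)) powr (1 / p)"
      using p by (intro powr_mono2) (auto intro!: divide_nonneg_nonneg sum_nonneg)
    also have "\<dots> = (C * K) powr (1 / p) * real d powr (\<beta> * m * (1 / p)) * (S / 2 ^ n) powr (1 / p)"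
      using C K S by (simp only: powr_mult powr_powr mult_nonneg_nonneg less_imp_le powr_ge_zero divide_nonneg_nonneg zero_le_power zero_le_numeral)
    also have "\<beta> * m * (1 / p) = \<beta> * max (1 / p) (1 / 2)"
      using p by (auto simp: m_def max_def field_simps)
    finally show "grad_Lp_norm p n f \<le> (C * K) powr (1 / p) *
        real d powr ((2 - theta p / pi) * max (1 / p) (1 / 2)) * cube_Lp_norm p n f"
      by (simp add: grad_Lp_norm_def cube_Lp_norm_def S_def \<beta>_def)
  qed
qed

theorem theorem15:
  fixes p :: real
  assumes "1 < p"
  shows "\<exists>C::real. 0 < C \<and>
    (\<forall>(n::nat) (d::nat) (f :: (nat \<Rightarrow> real) \<Rightarrow> complex).
      d \<in> {1..n} \<longrightarrow> degree_at_most n d f \<longrightarrow>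
      grad_Lp_norm p n f \<le>
        (if p < 2
         then C * real d powr (2 / p - theta p / (p * pi)) * ln (real d + 1) * cube_Lp_norm p n f
         else C * real d powr (1 - theta p / (2 * pi)) * cube_Lp_norm p n f))"
proof -
  obtain C where C: "0 < C" "\<And>n d f. 1 \<le> d \<Longrightarrow> degree_at_most n d f \<Longrightarrow>
    grad_Lp_norm p n f \<le> C * real d powr ((2 - theta p / pi) * max (1 / p) (1 / 2)) * cube_Lp_norm p n f"
    using grad_Lp_norm_le[OF assms] by blast
  have norm: "0 \<le> cube_Lp_norm p n f" for n and f :: "(nat \<Rightarrow> real) \<Rightarrow> complex"
    by (simp add: cube_Lp_norm_def)
  show ?thesis
  proof (cases "p < 2")
    case True
    have e: "(2 - theta p / pi) * max (1 / p) (1 / 2) = 2 / p - theta p / (p * pi)"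
      using True assms by (simp add: max_def field_simps)
    have "grad_Lp_norm p n f \<le> C / ln 2 * real d powr (2 / p - theta p / (p * pi)) * ln (real d + 1) * cube_Lp_norm p n f"
      if "d \<in> {1..n}" "degree_at_most n d f" for n d f
    proof -
      have "ln 2 \<le> ln (real d + 1)" using that by simp
      then have "C * 1 \<le> C * (ln (real d + 1) / ln 2)" using C by (intro mult_left_mono) auto
      then have "C * (real d powr (2 / p - theta p / (p * pi)) * cube_Lp_norm p n f) \<le>
          C / ln 2 * ln (real d + 1) * (real d powr (2 / p - theta p / (p * pi)) * cube_Lp_norm p n f)"
        using norm by (intro mult_right_mono) auto
      then show ?thesis using C(2)[of d n f] that unfolding e by (simp add: mult_ac)
    qed
    then show ?thesis using C True by (intro exI[of _ "C / ln 2"]) auto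
  next
    case False
    have e: "(2 - theta p / pi) * max (1 / p) (1 / 2) = 1 - theta p / (2 * pi)"
      using False assms by (simp add: max_def field_simps)
    show ?thesis using C False unfolding e by (intro exI[of _ C]) auto
  qed
qed

end
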